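(* Let $h\colon\mathbb{Z}^2\to\mathbb{Z}$ be a height function, and let $f\colon\mathcal{I}\cup\mathcal{U}\to K$ be the function defined by the octahedron recurrence below. Then for every $(n,i,j)\in\mathcal{U}$, $f(n,i,j)$ lies in the ring $R=\mathbb{Z}[x(i,j)^{\pm 1},a(i,j),b(i,j),c(i,j),d(i,j)]$, and when $f(n,i,j)$ is written as a Laurent polynomial in these variables, every monomial that appears has coefficient $1$. Moreover, in every monomial appearing, the exponent of each face variable $x(i',j')$ lies between $-1$ and $3$ inclusive, and the exponent of each edge variable ($a(\cdot,\cdot)$, $b(\cdot,\cdot)$, $c(\cdot,\cdot)$ or $d(\cdot,\cdot)$) is $0$ or $1$.
   Context: Let $\mathcal{L}=\{(n,i,j)\in\mathbb{Z}^3 : n\equiv i+j \pmod 2\}$. A height function is a map $h\colon\mathbb{Z}^2\to\mathbb{Z}$ such that (1) $|h(i_1,j_1)-h(i_2,j_2)|=1$ whenever $|i_1-i_2|+|j_1-j_2|=1$; (2) $h(i,j)\equiv i+j\pmod 2$ for all $(i,j)$; (3) $h(i,j)+|i|+|j|\to\infty$ as $|i|+|j|\to\infty$. Set $\mathcal{I}=\{(n,i,j)\in\mathcal{L}: n=h(i,j)\}$ and $\mathcal{U}=\{(n,i,j)\in\mathcal{L}: n>h(i,j)\}$. Introduce formal commuting variables: face variables $x(i,j)$ for all $(i,j)\in\mathbb{Z}^2$, and edge variables $a(i,j),b(i,j),c(i,j),d(i,j)$ for all $(i,j)\in\mathbb{Z}^2$ with $i+j$ odd; let $K$ be the field of rational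 functions in all these variables over $\mathbb{Q}$. Define $f\colon\mathcal{I}\cup\mathcal{U}\to K$ by $f(n,i,j)=x(i,j)$ for $(n,i,j)\in\mathcal{I}$, and for $(n,i,j)\in\mathcal{U}$ $$f(n,i,j)=\frac{a(i+n-1,j)\,c(i-n+1,j)\,f(n-1,i,j+1)\,f(n-1,i,j-1)+b(i,j+n-1)\,d(i,j-n+1)\,f(n-1,i+1,j)\,f(n-1,i-1,j)}{f(n-2,i,j)}.$$ (Condition (3) guarantees this recursion terminates, so $f$ is well defined.) *)

theory Defs
  imports
    "HOL-Library.Poly_Mapping"
    "HOL-Library.Countable"
    "HOL-Computational_Algebra.Fraction_Field"
    "HOL-Number_Theory.Cong"
begin

section \<open>Lattice and height functions\<close>

definition lattice :: "(int \<times> int \<times> int) set" where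
  "lattice = {(n, i, j). [n = i + j] (mod 2)}"

definition height_function :: "(int \<Rightarrow> int \<Rightarrow> int) \<Rightarrow> bool" where
  "height_function h \<longleftrightarrow>
     (\<forall>i1 j1 i2 j2. \<bar>i1 - i2\<bar> + \<bar>j1 - j2\<bar> = 1 \<longrightarrow> \<bar>h i1 j1 - h i2 j2\<bar> = 1) \<and>
     (\<forall>i j. [h i j = i + j] (mod 2)) \<and>
     filterlim (\<lambda>(i, j). h i j + \<bar>i\<bar> + \<bar>j\<bar>) at_top
       (filtercomap (\<lambda>(i, j). \<bar>i\<bar> + \<bar>j\<bar>) at_top)"

definition initial_set :: "(int \<Rightarrow> int \<Rightarrow> int) \<Rightarrow> (int \<times> int \<times> int) set" where
  "initial_set h = {(n, i, j) \<in> lattice. n = h i j}"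

definition upper_set :: "(int \<Rightarrow> int \<Rightarrow> int) \<Rightarrow> (int \<times> int \<times> int) set" where
  "upper_set h = {(n, i, j) \<in> lattice. n > h i j}"


section \<open>Variables and the field of rational functions\<close>

typedef edge = "{(i :: int, j :: int). odd (i + j)}"
  by (rule exI[of _ "(0, 1)"]) simp

datatype var =
    is_face: Face int int
  | EdgeA edge
  | EdgeB edge
  | EdgeC edge
  | EdgeD edge

instance edge :: countable
  by (rule countable_classI[of "\<lambda>e. to_nat (Rep_edge e)"]) (simp add: Rep_edge_inject)

instance var :: countable
  by countable_datatype

text \<open>
  The choice of linear order on the variables is immaterial. Some order is needed because
  the library proves that \<^typ>\<open>(var \<Rightarrow>\<^sub>0 nat) \<Rightarrow>\<^sub>0 rat\<close> is an integral domain only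
  for linearly ordered index types.
\<close>

instantiation var :: linorder
begin

definition less_eq_var :: "var \<Rightarrow> var \<Rightarrow> bool" where
  "(v :: var) \<le> w \<longleftrightarrow> to_nat v \<le> to_nat w"

definition less_var :: "var \<Rightarrow> var \<Rightarrow> bool" where
  "(v :: var) < w \<longleftrightarrow> to_nat v < to_nat w"

instance
  by standard (auto simp: less_eq_var_def less_var_def)

end

type_synonym ratfun = "((var \<Rightarrow>\<^sub>0 nat) \<Rightarrow>\<^sub>0 rat) fract"

definition Var :: "var \<Rightarrow> ratfun" where
  "Var v = Fract (Poly_Mapping.single (Poly_Mapping.single v 1) 1) 1"

text \<open>The following edge variables are meaningful only for odd \<open>i + j\<close>.\<close>

definition xvar :: "int \<Rightarrow> int \<Rightarrow> ratfun" where
  "xvar i j = Var (Face i j)"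

definition avar :: "int \<Rightarrow> int \<Rightarrow> ratfun" where
  "avar i j = Var (EdgeA (Abs_edge (i, j)))"

definition bvar :: "int \<Rightarrow> int \<Rightarrow> ratfun" where
  "bvar i j = Var (EdgeB (Abs_edge (i, j)))"

definition cvar :: "int \<Rightarrow> int \<Rightarrow> ratfun" where
  "cvar i j = Var (EdgeC (Abs_edge (i, j)))"

definition dvar :: "int \<Rightarrow> int \<Rightarrow> ratfun" where
  "dvar i j = Var (EdgeD (Abs_edge (i, j)))"


section \<open>Laurent polynomials\<close>

text \<open>
  A Laurent polynomial with integer coefficients is a finitely supported map from exponent
  vectors to coefficients; the monomials that appear in it are its keys.
\<close>

type_synonym laurent = "(var \<Rightarrow>\<^sub>0 int) \<Rightarrow>\<^sub>0 int"

definition laurent_monomial :: "(var \<Rightarrow>\<^sub>0 int) \<Rightarrow> ratfun" where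
  "laurent_monomial e = (\<Prod>v\<in>Poly_Mapping.keys e. Var v powi Poly_Mapping.lookup e v)"

definition laurent_value :: "laurent \<Rightarrow> ratfun" where
  "laurent_value p =
     (\<Sum>e\<in>Poly_Mapping.keys p. of_int (Poly_Mapping.lookup p e) * laurent_monomial e)"

text \<open>
  The ring \<open>\<int>[x, 1/x, a, b, c, d]\<close> as a subset of \<^typ>\<open>ratfun\<close>: only face
  variables may be inverted.
\<close>

definition laurent_ring :: "ratfun set" where
  "laurent_ring =
     laurent_value ` {p. \<forall>e\<in>Poly_Mapping.keys p. \<forall>v. \<not> is_face v \<longrightarrow> Poly_Mapping.lookup e v \<ge> 0}"


section \<open>The octahedron recurrence\<close>

text \<open>
  The recursion terminates on \<open>initial_set h \<union> upper_set h\<close> if \<open>h\<close> is a height function,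
  see \<open>octahedron_dom_height\<close> below. Only values at these points are meaningful.
\<close>

function (domintros) octahedron :: "(int \<Rightarrow> int \<Rightarrow> int) \<Rightarrow> int \<Rightarrow> int \<Rightarrow> int \<Rightarrow> ratfun" where
  "octahedron h n i j =
     (if n > h i j then
        (avar (i + n - 1) j * cvar (i - n + 1) j
           * octahedron h (n - 1) i (j + 1) * octahedron h (n - 1) i (j - 1)
         + bvar i (j + n - 1) * dvar i (j - n + 1)
           * octahedron h (n - 1) (i + 1) j * octahedron h (n - 1) (i - 1) j)
        / octahedron h (n - 2) i j
      else xvar i j)"
  by auto

lemma height_function_bounded_below:
  assumes "height_function h"
  shows "\<exists>m. \<forall>i j. h i j + \<bar>i\<bar> + \<bar>j\<bar> \<le> N \<longrightarrow> m \<le> h i j"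
proof -
  have "filterlim (\<lambda>(i, j). h i j + \<bar>i\<bar> + \<bar>j\<bar>) at_top
          (filtercomap (\<lambda>(i, j). \<bar>i\<bar> + \<bar>j\<bar>) at_top)"
    using assms by (simp add: height_function_def)
  hence "\<forall>\<^sub>F p in filtercomap (\<lambda>(i, j). \<bar>i\<bar> + \<bar>j\<bar>) at_top.
           (case p of (i, j) \<Rightarrow> h i j + \<bar>i\<bar> + \<bar>j\<bar>) \<ge> N + 1"
    unfolding filterlim_at_top by blast
  then obtain K where K: "\<And>i j. \<bar>i\<bar> + \<bar>j\<bar> \<ge> K \<Longrightarrow> h i j + \<bar>i\<bar> + \<bar>j\<bar> \<ge> N + 1"
    unfolding eventually_filtercomap eventually_at_top_linorder by fastforce
  define S where "S = (\<lambda>(i, j). h i j) ` ({-\<bar>K\<bar>..\<bar>K\<bar>} \<times> {-\<bar>K\<bar>..\<bar>K\<bar>})"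
  have "finite S"
    by (simp add: S_def)
  have "Min S \<le> h i j" if "h i j + \<bar>i\<bar> + \<bar>j\<bar> \<le> N" for i j
  proof (rule Min_le[OF \<open>finite S\<close>])
    have "\<bar>i\<bar> + \<bar>j\<bar> < K"
      using K[of i j] that by linarith
    hence "(i, j) \<in> {-\<bar>K\<bar>..\<bar>K\<bar>} \<times> {-\<bar>K\<bar>..\<bar>K\<bar>}"
      by auto
    thus "h i j \<in> S"
      unfolding S_def by force
  qed
  thus ?thesis
    by blast
qed

lemma height_function_neighbour:
  assumes "height_function h" "\<bar>i - i'\<bar> + \<bar>j - j'\<bar> = 1"
  shows "h i' j' \<le> h i j + 1"
proof -
  have "\<bar>h i j - h i' j'\<bar> = 1"
    using assms by (auto simp: height_function_def)
  thus ?thesis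
    by linarith
qed

lemma height_function_gap:
  assumes "height_function h" "(n, i, j) \<in> lattice" "n > h i j"
  shows "n \<ge> h i j + 2"
proof -
  have "[h i j = i + j] (mod 2)" "[n = i + j] (mod 2)"
    using assms by (auto simp: height_function_def lattice_def)
  hence "[n = h i j] (mod 2)"
    using cong_sym cong_trans by blast
  hence "even (n - h i j)"
    by (simp add: cong_iff_dvd_diff)
  thus ?thesis
    using assms(3) by presburger
qed

lemma octahedron_predecessors:
  assumes h: "height_function h" and "(n, i, j) \<in> upper_set h"
  shows "(n - 1, i, j + 1) \<in> initial_set h \<union> upper_set h"
    and "(n - 1, i, j - 1) \<in> initial_set h \<union> upper_set h"
    and "(n - 1, i + 1, j) \<in> initial_set h \<union> upper_set h"
    and "(n - 1, i - 1, j) \<in> initial_set h \<union> upper_set h"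
    and "(n - 2, i, j) \<in> initial_set h \<union> upper_set h"
proof -
  have L: "(n, i, j) \<in> lattice" and "n > h i j"
    using assms by (auto simp: upper_set_def)
  hence gap: "n \<ge> h i j + 2"
    using h by (intro height_function_gap)
  have e: "even (n - (i + j))"
    using L by (simp add: lattice_def cong_iff_dvd_diff)
  have 1: "(n - 1, i, j + 1) \<in> lattice" "(n - 1, i, j - 1) \<in> lattice"
    "(n - 1, i + 1, j) \<in> lattice" "(n - 1, i - 1, j) \<in> lattice" "(n - 2, i, j) \<in> lattice"
    using e unfolding lattice_def cong_iff_dvd_diff mem_Collect_eq prod.case by presburger+
  have 2: "h i (j + 1) \<le> n - 1" "h i (j - 1) \<le> n - 1" "h (i + 1) j \<le> n - 1"
    "h (i - 1) j \<le> n - 1" "h i j \<le> n - 2"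
    using gap height_function_neighbour[OF h, of i i j "j + 1"]
      height_function_neighbour[OF h, of i i j "j - 1"]
      height_function_neighbour[OF h, of i "i + 1" j j]
      height_function_neighbour[OF h, of i "i - 1" j j]
    by auto
  show "(n - 1, i, j + 1) \<in> initial_set h \<union> upper_set h"
    "(n - 1, i, j - 1) \<in> initial_set h \<union> upper_set h"
    "(n - 1, i + 1, j) \<in> initial_set h \<union> upper_set h"
    "(n - 1, i - 1, j) \<in> initial_set h \<union> upper_set h"
    "(n - 2, i, j) \<in> initial_set h \<union> upper_set h"
    using 1 2 by (auto simp: initial_set_def upper_set_def)
qed

theorem octahedron_dom_height:
  assumes h: "height_function h" and "(n, i, j) \<in> initial_set h \<union> upper_set h"
  shows "octahedron_dom (h, n, i, j)"
proof -
  define N where "N = n + \<bar>i\<bar> + \<bar>j\<bar>"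
  obtain m where m: "\<And>i j. h i j + \<bar>i\<bar> + \<bar>j\<bar> \<le> N \<Longrightarrow> m \<le> h i j"
    using height_function_bounded_below[OF h] by blast
  have "octahedron_dom (h, n, i, j)"
    if "(n, i, j) \<in> initial_set h \<union> upper_set h" "n + \<bar>i\<bar> + \<bar>j\<bar> \<le> N" for n i j
    using that
  proof (induction "nat (n - m)" arbitrary: n i j rule: less_induct)
    case less
    show ?case
    proof (cases "(n, i, j) \<in> upper_set h")
      case False
      hence "\<not> h i j < n"
        using less.prems(1) by (auto simp: initial_set_def)
      thus ?thesis
        by (auto intro: octahedron.domintros)
    next
      case True
      note pre = octahedron_predecessors[OF h True]
      have "h i j < n"
        using True by (simp add: upper_set_def)
      moreover from this have "m \<le> h i j"
        using less.prems(2) by (intro m) linarith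
      ultimately have dec: "nat (n - 1 - m) < nat (n - m)" "nat (n - 2 - m) < nat (n - m)"
        by linarith+
      show ?thesis
        by (rule octahedron.domintros; rule less.hyps)
           (use dec pre less.prems(2) in auto)
    qed
  qed
  thus ?thesis
    using assms(2) by (simp add: N_def)
qed

lemma octahedron_initial:
  assumes "height_function h" "(n, i, j) \<in> initial_set h"
  shows "octahedron h n i j = xvar i j"
proof -
  have "octahedron_dom (h, n, i, j)"
    using assms by (intro octahedron_dom_height) auto
  moreover have "\<not> n > h i j"
    using assms(2) by (simp add: initial_set_def)
  ultimately show ?thesis
    by (subst octahedron.psimps) simp_all
qed

lemma octahedron_upper:
  assumes "height_function h" "(n, i, j) \<in> upper_set h"
  shows "octahedron h n i j =
     (avar (i + n - 1) j * cvar (i - n + 1) j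
        * octahedron h (n - 1) i (j + 1) * octahedron h (n - 1) i (j - 1)
      + bvar i (j + n - 1) * dvar i (j - n + 1)
        * octahedron h (n - 1) (i + 1) j * octahedron h (n - 1) (i - 1) j)
     / octahedron h (n - 2) i j"
proof -
  have "octahedron_dom (h, n, i, j)"
    using assms by (intro octahedron_dom_height) auto
  moreover have "n > h i j"
    using assms(2) by (simp add: upper_set_def)
  ultimately show ?thesis
    by (subst octahedron.psimps) simp_all
qed

end

theory Submission
  imports Defs
begin

text \<open>
  Fix the target \<open>(n, i, j)\<close>. For every surface \<open>g\<close> between \<open>min h C\<close> and the cone
  \<open>C k l = n - \<bar>k - i\<bar> - \<bar>l - j\<bar>\<close>, the sum over the matchings of the crosses-and-wrenches graph of
  \<open>g\<close>, weighted by edge labels and by powers of the values of \<open>f\<close> on \<open>g\<close>, is the same: lowering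
  \<open>g\<close> by two at a local maximum is an urban renewal, and the local change of weights is exactly the
  recurrence. The cone has a single matching, of weight \<open>f(n, i, j)\<close>. On \<open>min h C\<close> the weights are
  Laurent monomials in the variables; distinct matchings give distinct monomials because the labels
  are distinct, and the exponent of a face variable is bounded by counting edges around the face.
\<close>

section \<open>Positive rational functions\<close>

text \<open>Induction on \<open>n\<close> alone is blocked by the division: nothing in the
  recurrence shows that \<open>f(n-2, i, j)\<close> divides the numerator exactly, or that no
  coefficient exceeds 1. Comparing sums over whole surfaces avoids this, since a flip alters the
  terms only near one face, and the recurrence enters there only as X X' = a c N S + b d E W. The
  values of \<open>f\<close> are merely required not to vanish; they do not, because the recurrence
  is subtraction-free, hence the detour through positivity. The cone is the lowest surface with unit
  steps through the target. By condition (3) it exceeds \<open>h\<close> at finitely many points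
  only, so finitely many flips connect the two surfaces and finite sets of sides and faces suffice.
  The constants: a face has four sides and at most four wrenches, and half of eight edges minus one
  is 3; a matching uses at most half of the edges around a face, whence -1. The theorem concerns
  every Laurent polynomial with the given value, so independence of Laurent monomials is needed as
  well.\<close>

inductive_set pos_polys :: "('a::comm_monoid_add \<Rightarrow>\<^sub>0 rat) set" where
  single: "c > 0 \<Longrightarrow> Poly_Mapping.single m c \<in> pos_polys"
| add: "p \<in> pos_polys \<Longrightarrow> q \<in> pos_polys \<Longrightarrow> p + q \<in> pos_polys"

lemma pos_polys_mult:
  assumes "p \<in> pos_polys" "q \<in> pos_polys"
  shows "p * q \<in> pos_polys"
  using assms(1)
proof induction
  case (single c m)
  show ?case
    using assms(2)
  proof induction
    case (single c' m')
    thus ?case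
      using \<open>c > 0\<close> by (simp add: mult_single pos_polys.single)
  qed (simp add: distrib_left pos_polys.add)
qed (simp add: distrib_right pos_polys.add)

text \<open>Being nonzero is not stable under sums; having nonnegative coefficients, one of them
  positive, is.\<close>

lemma pos_polys_nonzero:
  assumes "p \<in> pos_polys"
  shows "p \<noteq> 0"
proof -
  have "(\<forall>m. Poly_Mapping.lookup p m \<ge> 0) \<and> (\<exists>m. Poly_Mapping.lookup p m > 0)"
    using assms
  proof induction
    case (single c m)
    hence "Poly_Mapping.lookup (Poly_Mapping.single m c) m > 0"
      by simp
    with single show ?case
      by (auto simp: lookup_single when_def)
  next
    case (add p q)
    thus ?case
      by (metis lookup_add add_nonneg_nonneg add_pos_nonneg)
  qed
  thus ?thesis
    by auto
qed

definition pos_ratfuns :: "ratfun set" where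
  "pos_ratfuns = {Fract p q | p q. p \<in> pos_polys \<and> q \<in> pos_polys}"

lemma Var_pos: "Var v \<in> pos_ratfuns"
  unfolding pos_ratfuns_def Var_def
  by (metis (mono_tags, lifting) mem_Collect_eq pos_polys.single single_one zero_less_one)

lemma pos_ratfuns_nonzero:
  assumes "r \<in> pos_ratfuns"
  shows "r \<noteq> 0"
proof -
  obtain p q where r: "r = Fract p q" and "p \<in> pos_polys" "q \<in> pos_polys"
    using assms by (auto simp: pos_ratfuns_def)
  hence "p \<noteq> 0" "q \<noteq> 0"
    by (auto dest: pos_polys_nonzero)
  thus ?thesis
    by (simp add: r Zero_fract_def eq_fract(1))
qed

lemma pos_ratfuns_add:
  assumes "r \<in> pos_ratfuns" "s \<in> pos_ratfuns"
  shows "r + s \<in> pos_ratfuns"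
  using assms unfolding pos_ratfuns_def
  by (force simp: pos_polys_nonzero intro: pos_polys_mult pos_polys.add)

lemma pos_ratfuns_mult:
  assumes "r \<in> pos_ratfuns" "s \<in> pos_ratfuns"
  shows "r * s \<in> pos_ratfuns"
  using assms unfolding pos_ratfuns_def by (force intro: pos_polys_mult)

lemma pos_ratfuns_divide:
  assumes "r \<in> pos_ratfuns" "s \<in> pos_ratfuns"
  shows "r / s \<in> pos_ratfuns"
  using assms unfolding pos_ratfuns_def by (force intro: pos_polys_mult)

lemmas Var_nonzero = pos_ratfuns_nonzero[OF Var_pos]

text \<open>Sums, products and quotients of variables stay in this class. In particular no
  denominator of the recurrence is 0, where division would silently return 0.\<close>

lemma octahedron_pos:
  assumes "octahedron_dom (h, n, i, j)"
  shows "octahedron h n i j \<in> pos_ratfuns"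
  using assms
proof (induction rule: octahedron.pinduct)
  case (1 h n i j)
  show ?case
  proof (cases "n > h i j")
    case True
    show ?thesis
      unfolding octahedron.psimps[OF 1(1)] if_P[OF True]
      unfolding avar_def bvar_def cvar_def dvar_def
      by (intro pos_ratfuns_divide pos_ratfuns_add pos_ratfuns_mult Var_pos 1(2-)[OF True])
  next
    case False
    thus ?thesis
      by (simp add: octahedron.psimps[OF 1(1)] xvar_def Var_pos)
  qed
qed

section \<open>Laurent monomials\<close>

lemma laurent_monomial_superset:
  assumes "finite V" "Poly_Mapping.keys e \<subseteq> V"
  shows "laurent_monomial e = (\<Prod>v\<in>V. Var v powi Poly_Mapping.lookup e v)"
  unfolding laurent_monomial_def
  by (rule prod.mono_neutral_left) (use assms in \<open>auto simp: in_keys_iff\<close>)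

lemma laurent_monomial_0 [simp]: "laurent_monomial 0 = 1"
  by (simp add: laurent_monomial_def)

lemma laurent_monomial_add:
  "laurent_monomial (e + e') = laurent_monomial e * laurent_monomial e'"
proof -
  define V where "V = Poly_Mapping.keys e \<union> Poly_Mapping.keys e'"
  have "finite V" "Poly_Mapping.keys (e + e') \<subseteq> V"
    using keys_add[of e e'] by (auto simp: V_def)
  moreover have "Poly_Mapping.keys e \<subseteq> V" "Poly_Mapping.keys e' \<subseteq> V"
    by (auto simp: V_def)
  ultimately show ?thesis
    by (simp add: laurent_monomial_superset[of V] lookup_add power_int_add Var_nonzero prod.distrib)
qed

lemma laurent_monomial_single: "laurent_monomial (Poly_Mapping.single v k) = Var v powi k"
  by (simp add: laurent_monomial_superset[of "{v}"])

lemma laurent_monomial_sum: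
  "laurent_monomial (\<Sum>i\<in>I. e i) = (\<Prod>i\<in>I. laurent_monomial (e i))"
  by (induction I rule: infinite_finite_induct) (auto simp: laurent_monomial_add)

text \<open>Ties products of integer powers to monomials of the polynomial ring, where coefficients
  can be compared. The induction removes one variable at a time.\<close>

lemma laurent_monomial_of_nat:
  fixes e :: "var \<Rightarrow>\<^sub>0 int" and m :: "var \<Rightarrow>\<^sub>0 nat"
  assumes "\<And>v. Poly_Mapping.lookup e v = int (Poly_Mapping.lookup m v)"
  shows "laurent_monomial e = Fract (Poly_Mapping.single m 1) 1"
  using assms
proof (induction "\<Sum>v\<in>Poly_Mapping.keys m. Poly_Mapping.lookup m v" arbitrary: e m rule: less_induct)
  case less
  show ?case
  proof (cases "m = 0")
    case True
    hence "e = 0"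
      using less.prems by (intro poly_mapping_eqI) auto
    thus ?thesis
      using True by (simp add: One_fract_def)
  next
    case False
    then obtain v where v: "Poly_Mapping.lookup m v > 0"
      by (metis poly_mapping_eqI lookup_zero gr0I)
    define m' where "m' = m - Poly_Mapping.single v 1"
    define e' where "e' = e - Poly_Mapping.single v 1"
    have m: "m = Poly_Mapping.single v 1 + m'"
      using v by (intro poly_mapping_eqI) (auto simp: m'_def lookup_add lookup_minus lookup_single when_def)
    have e: "e = Poly_Mapping.single v 1 + e'"
      by (simp add: e'_def)
    have l: "Poly_Mapping.lookup m' w = Poly_Mapping.lookup m w - (if w = v then 1 else 0)" for w
      by (auto simp: m'_def lookup_minus lookup_single when_def)
    have "Poly_Mapping.lookup e' w = int (Poly_Mapping.lookup m' w)" for w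
      using less.prems[of w] v by (auto simp: e'_def m'_def lookup_minus lookup_single when_def)
    moreover have "(\<Sum>v\<in>Poly_Mapping.keys m'. Poly_Mapping.lookup m' v) < (\<Sum>v\<in>Poly_Mapping.keys m. Poly_Mapping.lookup m v)"
    proof -
      have "Poly_Mapping.keys m' \<subseteq> Poly_Mapping.keys m"
        by (auto simp: in_keys_iff l split: if_splits)
      hence "(\<Sum>v\<in>Poly_Mapping.keys m'. Poly_Mapping.lookup m' v) = (\<Sum>v\<in>Poly_Mapping.keys m. Poly_Mapping.lookup m' v)"
        by (intro sum.mono_neutral_left) (auto simp: in_keys_iff)
      also have "\<dots> < (\<Sum>v\<in>Poly_Mapping.keys m. Poly_Mapping.lookup m v)"
        by (rule sum_strict_mono_ex1) (use v in \<open>auto simp: l in_keys_iff intro!: bexI[of _ v]\<close>)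
      finally show ?thesis .
    qed
    ultimately have "laurent_monomial e' = Fract (Poly_Mapping.single m' 1) 1"
      using less.hyps by blast
    thus ?thesis
      unfolding e m laurent_monomial_add laurent_monomial_single
      by (simp add: Var_def mult_single)
  qed
qed

lemma laurent_value_superset:
  assumes "finite S" "Poly_Mapping.keys p \<subseteq> S"
  shows "laurent_value p = (\<Sum>e\<in>S. of_int (Poly_Mapping.lookup p e) * laurent_monomial e)"
  unfolding laurent_value_def
  by (rule sum.mono_neutral_left) (use assms in \<open>auto simp: in_keys_iff\<close>)

lemma laurent_value_0 [simp]: "laurent_value 0 = 0"
  by (simp add: laurent_value_def)

lemma laurent_value_diff: "laurent_value (p - q) = laurent_value p - laurent_value q"
proof -
  define S where "S = Poly_Mapping.keys p \<union> Poly_Mapping.keys q"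
  have "finite S" "Poly_Mapping.keys (p - q) \<subseteq> S" "Poly_Mapping.keys p \<subseteq> S" "Poly_Mapping.keys q \<subseteq> S"
    using keys_diff[of p q] by (auto simp: S_def)
  thus ?thesis
    by (simp add: laurent_value_superset[of S] lookup_minus algebra_simps sum_subtractf)
qed

lemma laurent_value_add: "laurent_value (p + q) = laurent_value p + laurent_value q"
  using laurent_value_diff[of "p + q" q] by simp

lemma laurent_value_single: "laurent_value (Poly_Mapping.single e c) = of_int c * laurent_monomial e"
  by (simp add: laurent_value_superset[of "{e}"])

lemma laurent_value_sum: "laurent_value (\<Sum>i\<in>I. p i) = (\<Sum>i\<in>I. laurent_value (p i))"
  by (induction I rule: infinite_finite_induct) (auto simp: laurent_value_add)

lemma of_int_times_Fract:
  "of_int c * Fract (Poly_Mapping.single m 1) 1 =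
   (Fract (Poly_Mapping.single m (of_int c)) 1 :: ratfun)"
proof -
  have "(of_int c :: ratfun) = Fract (of_int c) 1"
    by (cases c) (simp_all add: of_nat_fract One_fract_def flip: of_nat_Suc)
  also have "(of_int c :: (var \<Rightarrow>\<^sub>0 nat) \<Rightarrow>\<^sub>0 rat) = Poly_Mapping.single 0 (of_int c)"
    by simp
  finally show ?thesis
    by (simp only: mult_fract mult_single) simp
qed

lemma sum_Fract_1: "(\<Sum>i\<in>I. Fract (p i) 1) = Fract (\<Sum>i\<in>I. p i) 1"
  by (induction I rule: infinite_finite_induct) (auto simp: Zero_fract_def)

text \<open>Clearing denominators reduces the independence of Laurent monomials to that of monomials.\<close>

lemma laurent_value_eq_0_imp:
  assumes "laurent_value p = 0"
  shows "p = 0"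
proof (rule ccontr)
  assume "p \<noteq> 0"
  define E where "E = Poly_Mapping.keys p"
  define V where "V = (\<Union>e\<in>E. Poly_Mapping.keys e)"
  \<comment> \<open>A crude bound on all exponents at once: multiplying by the monomial
    \<open>s\<close>, with exponent \<open>N\<close> everywhere on \<open>V\<close>, makes every
    exponent nonnegative and keeps distinct exponent vectors distinct.\<close>
  define N where "N = (\<Sum>e\<in>E. \<Sum>v\<in>V. \<bar>Poly_Mapping.lookup e v\<bar>)"
  have fin: "finite E" "finite V"
    by (auto simp: E_def V_def)
  have N: "- Poly_Mapping.lookup e v \<le> N" if "e \<in> E" "v \<in> V" for e v
  proof -
    have "\<bar>Poly_Mapping.lookup e v\<bar> \<le> (\<Sum>v\<in>V. \<bar>Poly_Mapping.lookup e v\<bar>)"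
      by (rule member_le_sum) (use that fin in auto)
    also have "\<dots> \<le> N"
      unfolding N_def
      by (rule member_le_sum[where f = "\<lambda>e. \<Sum>v\<in>V. \<bar>Poly_Mapping.lookup e v\<bar>"])
         (use that fin in \<open>auto intro: sum_nonneg\<close>)
    finally show ?thesis
      by simp
  qed
  define s where "s = (\<Sum>v\<in>V. Poly_Mapping.single v N)"
  have s: "Poly_Mapping.lookup s v = (if v \<in> V then N else 0)" for v
    using fin by (simp add: s_def lookup_sum lookup_single when_def)
  define nn where "nn = (\<lambda>e. \<Sum>v\<in>V. Poly_Mapping.single v (nat (Poly_Mapping.lookup (e + s) v)))"
  have nn: "Poly_Mapping.lookup (e + s) v = int (Poly_Mapping.lookup (nn e) v)" if "e \<in> E" for e v
  proof (cases "v \<in> V")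
    case True
    thus ?thesis
      using fin N[OF that True] by (simp add: nn_def lookup_sum lookup_single when_def lookup_add s)
  next
    case False
    hence "Poly_Mapping.lookup e v = 0"
      using that by (auto simp: V_def in_keys_iff)
    thus ?thesis
      using fin False by (auto simp add: nn_def lookup_sum lookup_single when_def lookup_add s)
  qed
  have inj: "inj_on nn E"
  proof
    fix e e' assume "e \<in> E" "e' \<in> E" "nn e = nn e'"
    hence "e + s = e' + s"
      by (intro poly_mapping_eqI) (metis nn)
    thus "e = e'"
      by simp
  qed
  have "0 = laurent_value p * laurent_monomial s"
    using assms by simp
  also have "\<dots> = (\<Sum>e\<in>E. of_int (Poly_Mapping.lookup p e) * laurent_monomial (e + s))"
    by (simp add: laurent_value_def E_def sum_distrib_right laurent_monomial_add mult.assoc)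
  also have "\<dots> = (\<Sum>e\<in>E. Fract (Poly_Mapping.single (nn e) (of_int (Poly_Mapping.lookup p e))) 1)"
    by (intro sum.cong refl) (simp add: laurent_monomial_of_nat[OF nn] of_int_times_Fract)
  also have "\<dots> = Fract (\<Sum>e\<in>E. Poly_Mapping.single (nn e) (of_int (Poly_Mapping.lookup p e))) 1"
    by (rule sum_Fract_1)
  finally have 0: "(\<Sum>e\<in>E. Poly_Mapping.single (nn e) (of_int (Poly_Mapping.lookup p e)) :: (var \<Rightarrow>\<^sub>0 nat) \<Rightarrow>\<^sub>0 rat) = 0"
    by (simp add: Zero_fract_def eq_fract)
  obtain e where e: "e \<in> E"
    using \<open>p \<noteq> 0\<close> unfolding E_def by (metis keys_eq_empty ex_in_conv)
  have "0 = Poly_Mapping.lookup (\<Sum>e\<in>E. Poly_Mapping.single (nn e) (of_int (Poly_Mapping.lookup p e)) :: (var \<Rightarrow>\<^sub>0 nat) \<Rightarrow>\<^sub>0 rat) (nn e)"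
    unfolding 0 by simp
  also have "\<dots> = (\<Sum>e'\<in>E. if e' = e then of_int (Poly_Mapping.lookup p e) else 0)"
    unfolding lookup_sum
    by (intro sum.cong refl) (use e inj in \<open>auto simp: lookup_single when_def inj_on_def\<close>)
  also have "\<dots> = of_int (Poly_Mapping.lookup p e)"
    using e fin by simp
  finally show False
    using e by (simp add: E_def in_keys_iff)
qed

text \<open>Allows a property of one explicit expansion to be asserted of every expansion.\<close>

lemma laurent_value_inject: "laurent_value p = laurent_value q \<longleftrightarrow> p = q"
  using laurent_value_eq_0_imp[of "p - q"] by (auto simp: laurent_value_diff)

section \<open>Configurations\<close>

text \<open>
  \<open>Hor i j\<close> joins \<open>(i, j)\<close> to \<open>(i + 1, j)\<close> and \<open>Ver i j\<close> joins it to \<open>(i, j + 1)\<close>; they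
  stand for the dual edges of Speyer's graph, whose faces are the points of the plane lattice.
  A unit square whose two diagonals both have constant height is a vertex of degree four (a cross).
  Otherwise it is a pair of vertices joined by an unlabelled edge (a wrench) that separates the two
  corners of equal height; a matching contains this edge iff it contains no side of the square, so
  a matching is determined by its sides.
\<close>

datatype side = Hor int int | Ver int int

abbreviation hor :: "side set \<Rightarrow> int \<Rightarrow> int \<Rightarrow> int" where
  "hor M i j \<equiv> of_bool (Hor i j \<in> M)"

abbreviation ver :: "side set \<Rightarrow> int \<Rightarrow> int \<Rightarrow> int" where
  "ver M i j \<equiv> of_bool (Ver i j \<in> M)"

text \<open>Every vertex inside the square is matched exactly once. For a wrench, the two ends must
  see equally many sides, at most one each; the unlabelled edge is then determined. The first case
  separates the corners \<open>(i + 1, j)\<close> and \<open>(i, j + 1)\<close>, the second the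
  other two.\<close>

definition square_ok :: "(int \<Rightarrow> int \<Rightarrow> int) \<Rightarrow> side set \<Rightarrow> int \<Rightarrow> int \<Rightarrow> bool" where
  "square_ok g M i j \<longleftrightarrow>
     (if g i j \<noteq> g (i + 1) (j + 1) then
        hor M i j + ver M i j = hor M i (j + 1) + ver M (i + 1) j \<and> hor M i j + ver M i j \<le> 1
      else if g (i + 1) j \<noteq> g i (j + 1) then
        hor M i j + ver M (i + 1) j = hor M i (j + 1) + ver M i j \<and> hor M i j + ver M (i + 1) j \<le> 1
      else hor M i j + ver M i j + hor M i (j + 1) + ver M (i + 1) j = 1)"

definition config :: "(int \<Rightarrow> int \<Rightarrow> int) \<Rightarrow> side set \<Rightarrow> bool" where
  "config g M \<longleftrightarrow> (\<forall>i j. square_ok g M i j)"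

definition wrench_matched :: "side set \<Rightarrow> int \<Rightarrow> int \<Rightarrow> int \<Rightarrow> int \<Rightarrow> int" where
  "wrench_matched M i j m m' =
     of_bool (m \<noteq> m' \<and> Hor i j \<notin> M \<and> Ver i j \<notin> M \<and> Hor i (j + 1) \<notin> M \<and> Ver (i + 1) j \<notin> M)"

text \<open>
  Half the number of edges around the face, minus one, minus the number of matched edges. The
  number of wrenches around a face is twice the number of corners where the height of the
  neighbours increases anticlockwise, which avoids a division by two.
\<close>

definition face_exponent :: "(int \<Rightarrow> int \<Rightarrow> int) \<Rightarrow> side set \<Rightarrow> int \<Rightarrow> int \<Rightarrow> int" where
  "face_exponent g M i j =
     1 - (hor M i j + hor M (i - 1) j + ver M i j + ver M i (j - 1))
     + of_bool (g (i + 1) j < g i (j + 1)) + of_bool (g i (j + 1) < g (i - 1) j)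
     + of_bool (g (i - 1) j < g i (j - 1)) + of_bool (g i (j - 1) < g (i + 1) j)
     - wrench_matched M i j (g (i + 1) j) (g i (j + 1))
     - wrench_matched M (i - 1) j (g i (j + 1)) (g (i - 1) j)
     - wrench_matched M (i - 1) (j - 1) (g (i - 1) j) (g i (j - 1))
     - wrench_matched M i (j - 1) (g i (j - 1)) (g (i + 1) j)"

text \<open>Along a row, \<open>i + g i j\<close> is constant on descents and jumps by 2 on ascents,
  and \<open>i - g i j\<close> does the opposite. The index of the A or C variable is the odd value
  that is jumped over; B and D do the same along columns.\<close>

fun label :: "(int \<Rightarrow> int \<Rightarrow> int) \<Rightarrow> side \<Rightarrow> var" where
  "label g (Hor i j) =
     (if g i j < g (i + 1) j then EdgeA (Abs_edge (i + g i j + 1, j))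
      else EdgeC (Abs_edge (i - g (i + 1) j, j)))"
| "label g (Ver i j) =
     (if g i j < g i (j + 1) then EdgeB (Abs_edge (i, j + g i j + 1))
      else EdgeD (Abs_edge (i, j - g i (j + 1))))"

text \<open>Wrenches carry no variable and count only through \<open>face_exponent\<close>. Faces
  carry the value of \<open>f\<close> at the height of the surface, so intermediate surfaces have
  weights in the field that need not be monomials in the variables.\<close>

definition weight ::
  "(int \<Rightarrow> int \<Rightarrow> int \<Rightarrow> ratfun) \<Rightarrow> (int \<times> int) set \<Rightarrow> (int \<Rightarrow> int \<Rightarrow> int) \<Rightarrow> side set \<Rightarrow> ratfun" where
  "weight f P g M =
     (\<Prod>e\<in>M. Var (label g e)) * (\<Prod>(k, l)\<in>P. f (g k l) k l powi face_exponent g M k l)"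

text \<open>The finite windows \<open>B\<close> and \<open>P\<close> stay fixed while the surface
  moves, so that sums for different surfaces range over subsets of the same set;
  \<open>config\<close> still constrains the whole plane.\<close>

definition partition_sum ::
  "(int \<Rightarrow> int \<Rightarrow> int \<Rightarrow> ratfun) \<Rightarrow> side set \<Rightarrow> (int \<times> int) set \<Rightarrow> (int \<Rightarrow> int \<Rightarrow> int) \<Rightarrow> ratfun" where
  "partition_sum f B P g = (\<Sum>M | M \<subseteq> B \<and> config g M. weight f P g M)"

text \<open>Conditions (1) and (2) of a height function. Condition (3) fails for the cone and for
  every surface below it.\<close>

definition step_height :: "(int \<Rightarrow> int \<Rightarrow> int) \<Rightarrow> bool" where
  "step_height g \<longleftrightarrow>
     (\<forall>i j. \<bar>g (i + 1) j - g i j\<bar> = 1 \<and> \<bar>g i (j + 1) - g i j\<bar> = 1 \<and> even (g i j + i + j))"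

lemma step_heightD:
  assumes "step_height g"
  shows "\<bar>g (k + 1) l - g k l\<bar> = 1" "\<bar>g k (l + 1) - g k l\<bar> = 1" "even (g k l + k + l)"
    "\<bar>g k l - g (k - 1) l\<bar> = 1" "\<bar>g k l - g k (l - 1)\<bar> = 1"
proof -
  have *: "\<bar>g (k + 1) l - g k l\<bar> = 1 \<and> \<bar>g k (l + 1) - g k l\<bar> = 1 \<and> even (g k l + k + l)" for k l
    using assms unfolding step_height_def by blast
  show "\<bar>g (k + 1) l - g k l\<bar> = 1" "\<bar>g k (l + 1) - g k l\<bar> = 1" "even (g k l + k + l)"
    "\<bar>g k l - g (k - 1) l\<bar> = 1" "\<bar>g k l - g k (l - 1)\<bar> = 1"
    using *[of k l] *[of "k - 1" l] *[of k "l - 1"] by simp_all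
qed

section \<open>Urban renewal\<close>

text \<open>Coding the presence of a side by a boolean turns a sum over the sides of one face into
  nested sums over \<open>bool\<close>, which case analysis evaluates.\<close>

definition with_side :: "bool \<Rightarrow> side \<Rightarrow> side set \<Rightarrow> side set" where
  "with_side b e M = (if b then insert e M else M)"

lemma in_with_side [simp]: "e' \<in> with_side b e M \<longleftrightarrow> b \<and> e' = e \<or> e' \<in> M"
  by (auto simp: with_side_def)

lemma prod_with_side:
  fixes w :: "side \<Rightarrow> 'a::comm_semiring_1"
  assumes "finite M" "e \<notin> M"
  shows "prod w (with_side b e M) = w e ^ of_bool b * prod w M"
  using assms by (simp add: with_side_def)

lemma finite_with_side [simp]: "finite (with_side b e M) = finite M"
  by (simp add: with_side_def)

lemma sum_Pow_insert:
  fixes F :: "side set \<Rightarrow> 'a::comm_monoid_add"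
  assumes "finite A" "e \<notin> A"
  shows "sum F (Pow (insert e A)) = (\<Sum>M\<in>Pow A. \<Sum>b\<in>UNIV. F (with_side b e M))"
proof -
  have "sum F (Pow (insert e A)) = sum F (Pow A) + sum F (insert e ` Pow A)"
    unfolding Pow_insert by (rule sum.union_disjoint) (use assms in auto)
  also have "sum F (insert e ` Pow A) = (\<Sum>M\<in>Pow A. F (insert e M))"
    by (subst sum.reindex) (use assms in \<open>auto simp: inj_on_def\<close>)
  also have "sum F (Pow A) + \<dots> = (\<Sum>M\<in>Pow A. \<Sum>b\<in>UNIV. F (with_side b e M))"
    by (simp add: UNIV_bool with_side_def sum.distrib)
  finally show ?thesis .
qed

text \<open>The booleans \<open>p\<close>, \<open>q\<close>, \<open>r\<close>, \<open>t\<close>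
  prescribe how many sides are used at the NE, NW, SW and SE corners. Counting all sides forces p +
  r = q + t, otherwise both sums are empty. If all four are true, the left has two terms and the
  right one; if all are false, the reverse; both cases are \<open>XX'\<close>. If just two adjacent
  corners are true, each sum has one term, using opposite sides that carry the same label.\<close>

lemma urban_renewal_identity:
  fixes X X' a b c d xE xN xW xS :: "'a::field"
  assumes nz: "X \<noteq> 0" "X' \<noteq> 0" "xE \<noteq> 0" "xN \<noteq> 0" "xW \<noteq> 0" "xS \<noteq> 0"
  assumes XX': "X * X' = a * c * xN * xS + b * d * xE * xW"
  defines "ok \<equiv> \<lambda>u v p. of_bool u + of_bool v = (of_bool p :: int)"
  shows
    "(\<Sum>s\<in>UNIV. \<Sum>w\<in>UNIV. \<Sum>n\<in>UNIV. \<Sum>e\<in>UNIV.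
        if ok e n p \<and> ok n w q \<and> ok w s r \<and> ok s e t then
          c ^ of_bool e * d ^ of_bool n * a ^ of_bool w * b ^ of_bool s
          * X powi (1 - (of_bool e + of_bool n + of_bool w + of_bool s))
          * xE powi (- of_bool e) * xN powi (- of_bool n) * xW powi (- of_bool w) * xS powi (- of_bool s)
        else 0) =
     (\<Sum>s\<in>UNIV. \<Sum>w\<in>UNIV. \<Sum>n\<in>UNIV. \<Sum>e\<in>UNIV.
        if ok e n (\<not> p) \<and> ok n w (\<not> q) \<and> ok w s (\<not> r) \<and> ok s e (\<not> t) then
          a ^ of_bool e * b ^ of_bool n * c ^ of_bool w * d ^ of_bool s
          * X' powi (1 - (of_bool e + of_bool n + of_bool w + of_bool s))
          * xE powi (1 - of_bool t - of_bool p - of_bool e) * xN powi (1 - of_bool p - of_bool q - of_bool n)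
          * xW powi (1 - of_bool q - of_bool r - of_bool w) * xS powi (1 - of_bool r - of_bool t - of_bool s)
        else 0)"
proof -
  have XX'_left: "X * (X' * z) = a * c * xN * xS * z + b * d * xE * xW * z" for z
    unfolding mult.assoc[of X, symmetric] XX' by (rule distrib_right)
  show ?thesis
    unfolding ok_def UNIV_bool
    by (cases p; cases q; cases r; cases t; simp add: power_int_minus)
       (use nz XX' in \<open>simp_all add: field_simps XX'_left\<close>)
qed

definition incident_sides :: "int \<Rightarrow> int \<Rightarrow> side set" where
  "incident_sides i j = {Hor i j, Ver i j, Hor (i - 1) j, Ver i (j - 1)}"

definition near_faces :: "int \<Rightarrow> int \<Rightarrow> (int \<times> int) set" where
  "near_faces i j = {(i, j), (i + 1, j), (i, j + 1), (i - 1, j), (i, j - 1)}"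

text \<open>The four neighbours have equal height, so no wrench borders the centre: its face is a
  quadrilateral, as urban renewal requires.\<close>

locale local_flip =
  fixes g :: "int \<Rightarrow> int \<Rightarrow> int" and i j n :: int
  assumes step: "step_height g"
    and center: "g i j = n"
    and nbrs: "g (i + 1) j = n - 1" "g i (j + 1) = n - 1" "g (i - 1) j = n - 1" "g i (j - 1) = n - 1"
begin

definition g' :: "int \<Rightarrow> int \<Rightarrow> int" where
  "g' = (\<lambda>k l. if k = i \<and> l = j then n - 2 else g k l)"

definition extend :: "side set \<Rightarrow> bool \<Rightarrow> bool \<Rightarrow> bool \<Rightarrow> bool \<Rightarrow> side set" where
  "extend M s w u e =
     with_side e (Hor i j) (with_side u (Ver i j) (with_side w (Hor (i - 1) j) (with_side s (Ver i (j - 1)) M)))"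

text \<open>The part of \<open>config\<close> that the four sides of the flipped face cannot
  influence; it is the same before and after the flip.\<close>

definition rest_ok :: "side set \<Rightarrow> bool" where
  "rest_ok M \<longleftrightarrow>
     (\<forall>k l. (k, l) \<notin> {(i, j), (i - 1, j), (i - 1, j - 1), (i, j - 1)} \<longrightarrow> square_ok g M k l) \<and>
     \<not> (Hor i (j + 1) \<in> M \<and> Ver (i + 1) j \<in> M) \<and>
     \<not> (Hor (i - 1) (j + 1) \<in> M \<and> Ver (i - 1) j \<in> M) \<and>
     \<not> (Hor (i - 1) (j - 1) \<in> M \<and> Ver (i - 1) (j - 1) \<in> M) \<and>
     \<not> (Hor i (j - 1) \<in> M \<and> Ver (i + 1) (j - 1) \<in> M)"

text \<open>
  At each corner of the flipped face, the number (0 or 1) of matched sides of the face that a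
  configuration for \<open>g\<close> has is forced by the sides away from the face. For \<open>g'\<close> it is the complement.
\<close>

definition "cNE M \<longleftrightarrow> ((Hor i (j + 1) \<in> M \<or> Ver (i + 1) j \<in> M) \<longleftrightarrow> g (i + 1) (j + 1) \<noteq> n)"
definition "cNW M \<longleftrightarrow> ((Hor (i - 1) (j + 1) \<in> M \<or> Ver (i - 1) j \<in> M) \<longleftrightarrow> g (i - 1) (j + 1) \<noteq> n)"
definition "cSW M \<longleftrightarrow> ((Hor (i - 1) (j - 1) \<in> M \<or> Ver (i - 1) (j - 1) \<in> M) \<longleftrightarrow> g (i - 1) (j - 1) \<noteq> n)"
definition "cSE M \<longleftrightarrow> ((Hor i (j - 1) \<in> M \<or> Ver (i + 1) (j - 1) \<in> M) \<longleftrightarrow> g (i + 1) (j - 1) \<noteq> n)"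

abbreviation (input) "ok u v p \<equiv> of_bool u + of_bool v = (of_bool p :: int)"

section \<open>Admissible squares before and after a flip\<close>

lemma diagonal:
  "g (i + 1) (j + 1) = n \<or> g (i + 1) (j + 1) = n - 2"
  "g (i - 1) (j + 1) = n \<or> g (i - 1) (j + 1) = n - 2"
  "g (i - 1) (j - 1) = n \<or> g (i - 1) (j - 1) = n - 2"
  "g (i + 1) (j - 1) = n \<or> g (i + 1) (j - 1) = n - 2"
  using step_heightD(2)[OF step, of "i + 1" j] step_heightD(2)[OF step, of "i - 1" j]
    step_heightD(2)[OF step, of "i - 1" "j - 1"] step_heightD(2)[OF step, of "i + 1" "j - 1"] nbrs
  by auto

lemma in_extend:
  "Hor k l \<in> extend M s w u e \<longleftrightarrow> e \<and> k = i \<and> l = j \<or> w \<and> k = i - 1 \<and> l = j \<or> Hor k l \<in> M"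
  "Ver k l \<in> extend M s w u e \<longleftrightarrow> u \<and> k = i \<and> l = j \<or> s \<and> k = i \<and> l = j - 1 \<or> Ver k l \<in> M"
  by (auto simp: extend_def)

lemma notin_inner:
  assumes "M \<inter> incident_sides i j = {}"
  shows "Hor i j \<notin> M" "Ver i j \<notin> M" "Hor (i - 1) j \<notin> M" "Ver i (j - 1) \<notin> M"
  using assms by (auto simp: incident_sides_def)

lemma square_ok_extend_outer:
  assumes "(k, l) \<notin> {(i, j), (i - 1, j), (i - 1, j - 1), (i, j - 1)}"
  shows "square_ok g (extend M s w u e) k l = square_ok g M k l"
    and "square_ok g' (extend M s w u e) k l = square_ok g M k l"
proof -
  have "Hor k l \<in> extend M s w u e \<longleftrightarrow> Hor k l \<in> M" "Ver k l \<in> extend M s w u e \<longleftrightarrow> Ver k l \<in> M"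
    "Hor k (l + 1) \<in> extend M s w u e \<longleftrightarrow> Hor k (l + 1) \<in> M"
    "Ver (k + 1) l \<in> extend M s w u e \<longleftrightarrow> Ver (k + 1) l \<in> M"
    using assms by (auto simp: in_extend)
  moreover have "g' k l = g k l" "g' (k + 1) l = g (k + 1) l" "g' k (l + 1) = g k (l + 1)"
    "g' (k + 1) (l + 1) = g (k + 1) (l + 1)"
    using assms by (auto simp: g'_def)
  ultimately show "square_ok g (extend M s w u e) k l = square_ok g M k l"
    "square_ok g' (extend M s w u e) k l = square_ok g M k l"
    by (simp_all add: square_ok_def)
qed

text \<open>The height diagonally opposite the centre is \<open>n\<close> or \<open>n - 2\<close>,
  so lowering the centre turns a cross into a wrench and conversely. A cross asks for one side in
  total, a wrench for equal counts at its ends; hence the complement.\<close>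

lemma square_ok_extend_inner:
  assumes "M \<inter> incident_sides i j = {}"
  shows "square_ok g (extend M s w u e) i j \<longleftrightarrow>
      \<not> (Hor i (j + 1) \<in> M \<and> Ver (i + 1) j \<in> M) \<and> ok e u (cNE M)"
    and "square_ok g (extend M s w u e) (i - 1) j \<longleftrightarrow>
      \<not> (Hor (i - 1) (j + 1) \<in> M \<and> Ver (i - 1) j \<in> M) \<and> ok u w (cNW M)"
    and "square_ok g (extend M s w u e) (i - 1) (j - 1) \<longleftrightarrow>
      \<not> (Hor (i - 1) (j - 1) \<in> M \<and> Ver (i - 1) (j - 1) \<in> M) \<and> ok w s (cSW M)"
    and "square_ok g (extend M s w u e) i (j - 1) \<longleftrightarrow>
      \<not> (Hor i (j - 1) \<in> M \<and> Ver (i + 1) (j - 1) \<in> M) \<and> ok s e (cSE M)"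
    and "square_ok g' (extend M s w u e) i j \<longleftrightarrow>
      \<not> (Hor i (j + 1) \<in> M \<and> Ver (i + 1) j \<in> M) \<and> ok e u (\<not> cNE M)"
    and "square_ok g' (extend M s w u e) (i - 1) j \<longleftrightarrow>
      \<not> (Hor (i - 1) (j + 1) \<in> M \<and> Ver (i - 1) j \<in> M) \<and> ok u w (\<not> cNW M)"
    and "square_ok g' (extend M s w u e) (i - 1) (j - 1) \<longleftrightarrow>
      \<not> (Hor (i - 1) (j - 1) \<in> M \<and> Ver (i - 1) (j - 1) \<in> M) \<and> ok w s (\<not> cSW M)"
    and "square_ok g' (extend M s w u e) i (j - 1) \<longleftrightarrow>
      \<not> (Hor i (j - 1) \<in> M \<and> Ver (i + 1) (j - 1) \<in> M) \<and> ok s e (\<not> cSE M)"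
proof -
  note simps = square_ok_def in_extend g'_def cNE_def cNW_def cSW_def cSE_def center nbrs notin_inner[OF assms]
  show "square_ok g (extend M s w u e) i j \<longleftrightarrow>
      \<not> (Hor i (j + 1) \<in> M \<and> Ver (i + 1) j \<in> M) \<and> ok e u (cNE M)"
    using diagonal(1)
    by (elim disjE; cases "Hor i (j + 1) \<in> M"; cases "Ver (i + 1) j \<in> M"; cases e; cases u) (simp_all add: simps)
  show "square_ok g (extend M s w u e) (i - 1) j \<longleftrightarrow>
      \<not> (Hor (i - 1) (j + 1) \<in> M \<and> Ver (i - 1) j \<in> M) \<and> ok u w (cNW M)"
    using diagonal(2)
    by (elim disjE; cases "Hor (i - 1) (j + 1) \<in> M"; cases "Ver (i - 1) j \<in> M"; cases u; cases w) (simp_all add: simps)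
  show "square_ok g (extend M s w u e) (i - 1) (j - 1) \<longleftrightarrow>
      \<not> (Hor (i - 1) (j - 1) \<in> M \<and> Ver (i - 1) (j - 1) \<in> M) \<and> ok w s (cSW M)"
    using diagonal(3)
    by (elim disjE; cases "Hor (i - 1) (j - 1) \<in> M"; cases "Ver (i - 1) (j - 1) \<in> M"; cases w; cases s) (simp_all add: simps)
  show "square_ok g (extend M s w u e) i (j - 1) \<longleftrightarrow>
      \<not> (Hor i (j - 1) \<in> M \<and> Ver (i + 1) (j - 1) \<in> M) \<and> ok s e (cSE M)"
    using diagonal(4)
    by (elim disjE; cases "Hor i (j - 1) \<in> M"; cases "Ver (i + 1) (j - 1) \<in> M"; cases s; cases e) (simp_all add: simps)
  show "square_ok g' (extend M s w u e) i j \<longleftrightarrow>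
      \<not> (Hor i (j + 1) \<in> M \<and> Ver (i + 1) j \<in> M) \<and> ok e u (\<not> cNE M)"
    using diagonal(1)
    by (elim disjE; cases "Hor i (j + 1) \<in> M"; cases "Ver (i + 1) j \<in> M"; cases e; cases u) (simp_all add: simps)
  show "square_ok g' (extend M s w u e) (i - 1) j \<longleftrightarrow>
      \<not> (Hor (i - 1) (j + 1) \<in> M \<and> Ver (i - 1) j \<in> M) \<and> ok u w (\<not> cNW M)"
    using diagonal(2)
    by (elim disjE; cases "Hor (i - 1) (j + 1) \<in> M"; cases "Ver (i - 1) j \<in> M"; cases u; cases w) (simp_all add: simps)
  show "square_ok g' (extend M s w u e) (i - 1) (j - 1) \<longleftrightarrow>
      \<not> (Hor (i - 1) (j - 1) \<in> M \<and> Ver (i - 1) (j - 1) \<in> M) \<and> ok w s (\<not> cSW M)"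
    using diagonal(3)
    by (elim disjE; cases "Hor (i - 1) (j - 1) \<in> M"; cases "Ver (i - 1) (j - 1) \<in> M"; cases w; cases s) (simp_all add: simps)
  show "square_ok g' (extend M s w u e) i (j - 1) \<longleftrightarrow>
      \<not> (Hor i (j - 1) \<in> M \<and> Ver (i + 1) (j - 1) \<in> M) \<and> ok s e (\<not> cSE M)"
    using diagonal(4)
    by (elim disjE; cases "Hor i (j - 1) \<in> M"; cases "Ver (i + 1) (j - 1) \<in> M"; cases s; cases e) (simp_all add: simps)
qed

lemma config_extend:
  assumes "M \<inter> incident_sides i j = {}"
  shows "config g (extend M s w u e) \<longleftrightarrow>
      rest_ok M \<and> ok e u (cNE M) \<and> ok u w (cNW M) \<and> ok w s (cSW M) \<and> ok s e (cSE M)"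
    and "config g' (extend M s w u e) \<longleftrightarrow>
      rest_ok M \<and> ok e u (\<not> cNE M) \<and> ok u w (\<not> cNW M) \<and> ok w s (\<not> cSW M) \<and> ok s e (\<not> cSE M)"
proof -
  let ?Q = "{(i, j), (i - 1, j), (i - 1, j - 1), (i, j - 1)}"
  have split: "(\<forall>k l. R k l) \<longleftrightarrow>
      R i j \<and> R (i - 1) j \<and> R (i - 1) (j - 1) \<and> R i (j - 1) \<and> (\<forall>k l. (k, l) \<notin> ?Q \<longrightarrow> R k l)"
    for R :: "int \<Rightarrow> int \<Rightarrow> bool"
  proof -
    have "(\<forall>k l. R k l) \<longleftrightarrow> (\<forall>(k, l)\<in>Q. R k l) \<and> (\<forall>k l. (k, l) \<notin> Q \<longrightarrow> R k l)" for Q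
      by auto
    from this[of ?Q] show ?thesis
      by simp
  qed
  have outer:
    "(\<forall>k l. (k, l) \<notin> ?Q \<longrightarrow> square_ok g (extend M s w u e) k l) \<longleftrightarrow>
     (\<forall>k l. (k, l) \<notin> ?Q \<longrightarrow> square_ok g M k l)"
    "(\<forall>k l. (k, l) \<notin> ?Q \<longrightarrow> square_ok g' (extend M s w u e) k l) \<longleftrightarrow>
     (\<forall>k l. (k, l) \<notin> ?Q \<longrightarrow> square_ok g M k l)"
    by (intro all_cong1 imp_cong refl square_ok_extend_outer; assumption)+
  show "config g (extend M s w u e) \<longleftrightarrow>
      rest_ok M \<and> ok e u (cNE M) \<and> ok u w (cNW M) \<and> ok w s (cSW M) \<and> ok s e (cSE M)"
    unfolding config_def rest_ok_def
    by (subst split[of "square_ok g (extend M s w u e)"])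
       (simp only: square_ok_extend_inner[OF assms] outer conj_ac)
  show "config g' (extend M s w u e) \<longleftrightarrow>
      rest_ok M \<and> ok e u (\<not> cNE M) \<and> ok u w (\<not> cNW M) \<and> ok w s (\<not> cSW M) \<and> ok s e (\<not> cSE M)"
    unfolding config_def rest_ok_def
    by (subst split[of "square_ok g' (extend M s w u e)"])
       (simp only: square_ok_extend_inner[OF assms] outer conj_ac)
qed

section \<open>Face exponents before and after a flip\<close>

lemma ok_iff: "ok u v p \<longleftrightarrow> (p \<longleftrightarrow> u \<or> v) \<and> \<not> (u \<and> v)"
  by auto

text \<open>The heights \<open>m\<close> and \<open>m'\<close> are left free because the two faces
  adjacent to the flipped one at a corner see the same wrench with their arguments in opposite
  orders. The premise says that a cross has no wrench.\<close>

lemma wrench_matched_corner: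
  assumes M: "M \<inter> incident_sides i j = {}" and cfg: "config g (extend M s w u e)"
  shows "(g (i + 1) (j + 1) = n \<Longrightarrow> m = m') \<Longrightarrow>
      wrench_matched (extend M s w u e) i j m m' = of_bool (m \<noteq> m' \<and> \<not> cNE M)"
    and "(g (i - 1) (j + 1) = n \<Longrightarrow> m = m') \<Longrightarrow>
      wrench_matched (extend M s w u e) (i - 1) j m m' = of_bool (m \<noteq> m' \<and> \<not> cNW M)"
    and "(g (i - 1) (j - 1) = n \<Longrightarrow> m = m') \<Longrightarrow>
      wrench_matched (extend M s w u e) (i - 1) (j - 1) m m' = of_bool (m \<noteq> m' \<and> \<not> cSW M)"
    and "(g (i + 1) (j - 1) = n \<Longrightarrow> m = m') \<Longrightarrow>
      wrench_matched (extend M s w u e) i (j - 1) m m' = of_bool (m \<noteq> m' \<and> \<not> cSE M)"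
proof -
  have c: "cNE M \<longleftrightarrow> e \<or> u" "cNW M \<longleftrightarrow> u \<or> w" "cSW M \<longleftrightarrow> w \<or> s" "cSE M \<longleftrightarrow> s \<or> e"
    using cfg unfolding config_extend(1)[OF M] ok_iff by simp_all
  note simps = wrench_matched_def in_extend notin_inner[OF M]
  show "wrench_matched (extend M s w u e) i j m m' = of_bool (m \<noteq> m' \<and> \<not> cNE M)"
    if "g (i + 1) (j + 1) = n \<Longrightarrow> m = m'"
    using that c(1) by (cases "m = m'") (auto simp: simps cNE_def)
  show "wrench_matched (extend M s w u e) (i - 1) j m m' = of_bool (m \<noteq> m' \<and> \<not> cNW M)"
    if "g (i - 1) (j + 1) = n \<Longrightarrow> m = m'"
    using that c(2) by (cases "m = m'") (auto simp: simps cNW_def)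
  show "wrench_matched (extend M s w u e) (i - 1) (j - 1) m m' = of_bool (m \<noteq> m' \<and> \<not> cSW M)"
    if "g (i - 1) (j - 1) = n \<Longrightarrow> m = m'"
    using that c(3) by (cases "m = m'") (auto simp: simps cSW_def)
  show "wrench_matched (extend M s w u e) i (j - 1) m m' = of_bool (m \<noteq> m' \<and> \<not> cSE M)"
    if "g (i + 1) (j - 1) = n \<Longrightarrow> m = m'"
    using that c(4) by (cases "m = m'") (auto simp: simps cSE_def)
qed

lemma wrench_matched_corner':
  assumes M: "M \<inter> incident_sides i j = {}" and cfg: "config g' (extend M s w u e)"
  shows "(g (i + 1) (j + 1) \<noteq> n \<Longrightarrow> m = m') \<Longrightarrow>
      wrench_matched (extend M s w u e) i j m m' = of_bool (m \<noteq> m' \<and> cNE M)"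
    and "(g (i - 1) (j + 1) \<noteq> n \<Longrightarrow> m = m') \<Longrightarrow>
      wrench_matched (extend M s w u e) (i - 1) j m m' = of_bool (m \<noteq> m' \<and> cNW M)"
    and "(g (i - 1) (j - 1) \<noteq> n \<Longrightarrow> m = m') \<Longrightarrow>
      wrench_matched (extend M s w u e) (i - 1) (j - 1) m m' = of_bool (m \<noteq> m' \<and> cSW M)"
    and "(g (i + 1) (j - 1) \<noteq> n \<Longrightarrow> m = m') \<Longrightarrow>
      wrench_matched (extend M s w u e) i (j - 1) m m' = of_bool (m \<noteq> m' \<and> cSE M)"
proof -
  have c: "\<not> cNE M \<longleftrightarrow> e \<or> u" "\<not> cNW M \<longleftrightarrow> u \<or> w" "\<not> cSW M \<longleftrightarrow> w \<or> s" "\<not> cSE M \<longleftrightarrow> s \<or> e"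
    using cfg unfolding config_extend(2)[OF M] ok_iff by simp_all
  note simps = wrench_matched_def in_extend notin_inner[OF M]
  show "wrench_matched (extend M s w u e) i j m m' = of_bool (m \<noteq> m' \<and> cNE M)"
    if "g (i + 1) (j + 1) \<noteq> n \<Longrightarrow> m = m'"
    using that c(1) by (cases "m = m'") (auto simp: simps cNE_def)
  show "wrench_matched (extend M s w u e) (i - 1) j m m' = of_bool (m \<noteq> m' \<and> cNW M)"
    if "g (i - 1) (j + 1) \<noteq> n \<Longrightarrow> m = m'"
    using that c(2) by (cases "m = m'") (auto simp: simps cNW_def)
  show "wrench_matched (extend M s w u e) (i - 1) (j - 1) m m' = of_bool (m \<noteq> m' \<and> cSW M)"
    if "g (i - 1) (j - 1) \<noteq> n \<Longrightarrow> m = m'"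
    using that c(3) by (cases "m = m'") (auto simp: simps cSW_def)
  show "wrench_matched (extend M s w u e) i (j - 1) m m' = of_bool (m \<noteq> m' \<and> cSE M)"
    if "g (i + 1) (j - 1) \<noteq> n \<Longrightarrow> m = m'"
    using that c(4) by (cases "m = m'") (auto simp: simps cSE_def)
qed

lemma wrench_matched_outer:
  assumes "(k, l) \<notin> {(i, j), (i - 1, j), (i - 1, j - 1), (i, j - 1)}"
  shows "wrench_matched (extend M s w u e) k l = wrench_matched M k l"
  using assms by (auto simp: wrench_matched_def in_extend fun_eq_iff)

text \<open>The analogue for the bare set \<open>M\<close>, which need not be a configuration. Its
  exponents serve as the common reference for both surfaces.\<close>

lemma wrench_matched_corner_outer:
  assumes "M \<inter> incident_sides i j = {}"
  shows "(g (i + 1) (j + 1) = n \<Longrightarrow> m = m') \<Longrightarrow>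
      wrench_matched M i j m m' = of_bool (m \<noteq> m' \<and> \<not> cNE M)"
    and "(g (i - 1) (j + 1) = n \<Longrightarrow> m = m') \<Longrightarrow>
      wrench_matched M (i - 1) j m m' = of_bool (m \<noteq> m' \<and> \<not> cNW M)"
    and "(g (i - 1) (j - 1) = n \<Longrightarrow> m = m') \<Longrightarrow>
      wrench_matched M (i - 1) (j - 1) m m' = of_bool (m \<noteq> m' \<and> \<not> cSW M)"
    and "(g (i + 1) (j - 1) = n \<Longrightarrow> m = m') \<Longrightarrow>
      wrench_matched M i (j - 1) m m' = of_bool (m \<noteq> m' \<and> \<not> cSE M)"
  using notin_inner[OF assms]
  by (auto simp: wrench_matched_def cNE_def cNW_def cSW_def cSE_def)

lemma face_exponent_center:
  assumes "M \<inter> incident_sides i j = {}"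
  shows "face_exponent g (extend M s w u e) i j = 1 - (of_bool e + of_bool u + of_bool w + of_bool s)"
    and "face_exponent g' (extend M s w u e) i j = 1 - (of_bool e + of_bool u + of_bool w + of_bool s)"
  using notin_inner[OF assms] nbrs by (simp_all add: face_exponent_def wrench_matched_def g'_def in_extend)

lemma face_exponent_neighbour:
  assumes "M \<inter> incident_sides i j = {}" "config g (extend M s w u e)"
  shows "face_exponent g (extend M s w u e) (i + 1) j = face_exponent g M (i + 1) j - of_bool e"
    and "face_exponent g (extend M s w u e) i (j + 1) = face_exponent g M i (j + 1) - of_bool u"
    and "face_exponent g (extend M s w u e) (i - 1) j = face_exponent g M (i - 1) j - of_bool w"
    and "face_exponent g (extend M s w u e) i (j - 1) = face_exponent g M i (j - 1) - of_bool s"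
  using notin_inner[OF assms(1)]
  by (simp_all add: face_exponent_def in_extend center wrench_matched_corner[OF assms]
      wrench_matched_corner_outer[OF assms(1)] wrench_matched_outer)

text \<open>Let w be 1 if a corner has a wrench before the flip and 0 otherwise, and let c be the
  forced count there. Half the change in the number of wrenches is 1/2 - w, and the number of
  matched wrenches grows by (1 - w) c - w (1 - c) = c - w. The corner thus contributes 1/2 - c,
  independently of w; two corners meet each neighbour.\<close>

lemma face_exponent_neighbour':
  assumes "M \<inter> incident_sides i j = {}" "config g' (extend M s w u e)"
  shows "face_exponent g' (extend M s w u e) (i + 1) j =
      face_exponent g M (i + 1) j + (1 - of_bool (cSE M) - of_bool (cNE M) - of_bool e)"
    and "face_exponent g' (extend M s w u e) i (j + 1) =
      face_exponent g M i (j + 1) + (1 - of_bool (cNE M) - of_bool (cNW M) - of_bool u)"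
    and "face_exponent g' (extend M s w u e) (i - 1) j =
      face_exponent g M (i - 1) j + (1 - of_bool (cNW M) - of_bool (cSW M) - of_bool w)"
    and "face_exponent g' (extend M s w u e) i (j - 1) =
      face_exponent g M i (j - 1) + (1 - of_bool (cSW M) - of_bool (cSE M) - of_bool s)"
proof -
  note simps = face_exponent_def in_extend center g'_def wrench_matched_corner'[OF assms]
    wrench_matched_corner_outer[OF assms(1)] wrench_matched_outer notin_inner[OF assms(1)]
  show "face_exponent g' (extend M s w u e) (i + 1) j =
      face_exponent g M (i + 1) j + (1 - of_bool (cSE M) - of_bool (cNE M) - of_bool e)"
    using diagonal(1,4) by (elim disjE) (simp_all add: simps)
  show "face_exponent g' (extend M s w u e) i (j + 1) =
      face_exponent g M i (j + 1) + (1 - of_bool (cNE M) - of_bool (cNW M) - of_bool u)"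
    using diagonal(1,2) by (elim disjE) (simp_all add: simps)
  show "face_exponent g' (extend M s w u e) (i - 1) j =
      face_exponent g M (i - 1) j + (1 - of_bool (cNW M) - of_bool (cSW M) - of_bool w)"
    using diagonal(2,3) by (elim disjE) (simp_all add: simps)
  show "face_exponent g' (extend M s w u e) i (j - 1) =
      face_exponent g M i (j - 1) + (1 - of_bool (cSW M) - of_bool (cSE M) - of_bool s)"
    using diagonal(3,4) by (elim disjE) (simp_all add: simps)
qed

text \<open>The delicate faces are the diagonal neighbours, which share a square with the flipped
  face. A wrench bordering them there would need unequal heights at two of \<open>nbrs\<close>,
  which are all \<open>n - 1\<close>.\<close>

lemma face_exponent_other:
  assumes "(k, l) \<notin> {(i, j), (i + 1, j), (i, j + 1), (i - 1, j), (i, j - 1)}"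
  shows "face_exponent g (extend M s w u e) k l = face_exponent g M k l"
    and "face_exponent g' (extend M s w u e) k l = face_exponent g M k l"
proof -
  have "wrench_matched (extend M s w u e) k l (g (k + 1) l) (g k (l + 1)) =
      wrench_matched M k l (g (k + 1) l) (g k (l + 1))"
  proof (cases "(k, l) = (i - 1, j - 1)")
    case True
    thus ?thesis
      by (auto simp: wrench_matched_def nbrs)
  next
    case False
    thus ?thesis
      using assms by (subst wrench_matched_outer) auto
  qed
  moreover have "wrench_matched (extend M s w u e) (k - 1) l (g k (l + 1)) (g (k - 1) l) =
      wrench_matched M (k - 1) l (g k (l + 1)) (g (k - 1) l)"
  proof (cases "(k - 1, l) = (i, j - 1)")
    case True
    hence "k = i + 1" "l = j - 1"
      by auto
    thus ?thesis
      by (simp add: wrench_matched_def nbrs)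
  next
    case False
    thus ?thesis
      using assms by (subst wrench_matched_outer) auto
  qed
  moreover have "wrench_matched (extend M s w u e) (k - 1) (l - 1) (g (k - 1) l) (g k (l - 1)) =
      wrench_matched M (k - 1) (l - 1) (g (k - 1) l) (g k (l - 1))"
  proof (cases "(k - 1, l - 1) = (i, j)")
    case True
    hence "k = i + 1" "l = j + 1"
      by auto
    thus ?thesis
      by (simp add: wrench_matched_def nbrs)
  next
    case False
    thus ?thesis
      using assms by (subst wrench_matched_outer) auto
  qed
  moreover have "wrench_matched (extend M s w u e) k (l - 1) (g k (l - 1)) (g (k + 1) l) =
      wrench_matched M k (l - 1) (g k (l - 1)) (g (k + 1) l)"
  proof (cases "(k, l - 1) = (i - 1, j)")
    case True
    hence "k = i - 1" "l = j + 1"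
      by auto
    thus ?thesis
      by (simp add: wrench_matched_def nbrs)
  next
    case False
    thus ?thesis
      using assms by (subst wrench_matched_outer) auto
  qed
  moreover have "Hor k l \<in> extend M s w u e \<longleftrightarrow> Hor k l \<in> M"
    "Hor (k - 1) l \<in> extend M s w u e \<longleftrightarrow> Hor (k - 1) l \<in> M"
    "Ver k l \<in> extend M s w u e \<longleftrightarrow> Ver k l \<in> M"
    "Ver k (l - 1) \<in> extend M s w u e \<longleftrightarrow> Ver k (l - 1) \<in> M"
    using assms by (auto simp: in_extend)
  moreover have "g' (k + 1) l = g (k + 1) l" "g' (k - 1) l = g (k - 1) l"
    "g' k (l + 1) = g k (l + 1)" "g' k (l - 1) = g k (l - 1)"
    using assms by (auto simp: g'_def)
  ultimately show "face_exponent g (extend M s w u e) k l = face_exponent g M k l"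
    "face_exponent g' (extend M s w u e) k l = face_exponent g M k l"
    by (simp_all add: face_exponent_def)
qed

text \<open>A flip exchanges the labels of opposite sides of the face and leaves the set of four
  labels unchanged.\<close>

lemma label_inner:
  "label g (Hor i j) = EdgeC (Abs_edge (i - n + 1, j))"
  "label g (Ver i j) = EdgeD (Abs_edge (i, j - n + 1))"
  "label g (Hor (i - 1) j) = EdgeA (Abs_edge (i + n - 1, j))"
  "label g (Ver i (j - 1)) = EdgeB (Abs_edge (i, j + n - 1))"
  "label g' (Hor i j) = EdgeA (Abs_edge (i + n - 1, j))"
  "label g' (Ver i j) = EdgeB (Abs_edge (i, j + n - 1))"
  "label g' (Hor (i - 1) j) = EdgeC (Abs_edge (i - n + 1, j))"
  "label g' (Ver i (j - 1)) = EdgeD (Abs_edge (i, j - n + 1))"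
  by (simp_all add: center nbrs g'_def) (simp_all add: algebra_simps)

lemma label_outer:
  assumes "x \<notin> incident_sides i j"
  shows "label g' x = label g x"
  using assms by (cases x) (auto simp: g'_def incident_sides_def)

section \<open>Weights across a flip\<close>

lemma prod_extend:
  fixes w :: "side \<Rightarrow> 'a::comm_semiring_1"
  assumes "M \<inter> incident_sides i j = {}" "finite M"
  shows "prod w (extend M s v u e) =
    w (Hor i j) ^ of_bool e * w (Ver i j) ^ of_bool u * w (Hor (i - 1) j) ^ of_bool v *
    w (Ver i (j - 1)) ^ of_bool s * prod w M"
  using assms(2) notin_inner[OF assms(1)]
  by (simp add: extend_def prod_with_side mult.assoc)

lemma prod_near_faces:
  fixes w :: "int \<times> int \<Rightarrow> 'a::comm_monoid_mult"
  assumes "finite P" "near_faces i j \<subseteq> P"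
  shows "prod w P = prod w (P - near_faces i j) *
    (w (i, j) * w (i + 1, j) * w (i, j + 1) * w (i - 1, j) * w (i, j - 1))"
proof -
  have "prod w P = prod w (P - near_faces i j) * prod w (near_faces i j)"
    using assms by (intro prod.subset_diff)
  also have "prod w (near_faces i j) = w (i, j) * w (i + 1, j) * w (i, j + 1) * w (i - 1, j) * w (i, j - 1)"
    by (simp add: near_faces_def mult.assoc)
  finally show ?thesis .
qed

lemma sum_Pow_extend:
  fixes F :: "side set \<Rightarrow> 'a::comm_monoid_add"
  assumes "finite B" "incident_sides i j \<subseteq> B"
  shows "sum F (Pow B) =
    (\<Sum>M\<in>Pow (B - incident_sides i j). \<Sum>s\<in>UNIV. \<Sum>w\<in>UNIV. \<Sum>u\<in>UNIV. \<Sum>e\<in>UNIV. F (extend M s w u e))"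
proof -
  have B: "B = insert (Hor i j) (insert (Ver i j) (insert (Hor (i - 1) j) (insert (Ver i (j - 1)) (B - incident_sides i j))))"
    using assms(2) by (auto simp: incident_sides_def)
  have fin: "finite (B - incident_sides i j)"
    using assms(1) by simp
  show ?thesis
    by (subst B, (subst sum_Pow_insert; (use fin in \<open>force simp: incident_sides_def\<close>)?)+)
       (simp add: extend_def)
qed

context
  fixes f :: "int \<Rightarrow> int \<Rightarrow> int \<Rightarrow> ratfun" and B :: "side set" and P :: "(int \<times> int) set"
  assumes fin: "finite B" "finite P"
    and sub: "incident_sides i j \<subseteq> B" "near_faces i j \<subseteq> P"
    and nz: "f n i j \<noteq> 0" "f (n - 2) i j \<noteq> 0" "f (n - 1) (i + 1) j \<noteq> 0" "f (n - 1) i (j + 1) \<noteq> 0"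
      "f (n - 1) (i - 1) j \<noteq> 0" "f (n - 1) i (j - 1) \<noteq> 0"
    and rec: "f n i j * f (n - 2) i j =
      avar (i + n - 1) j * cvar (i - n + 1) j * f (n - 1) i (j + 1) * f (n - 1) i (j - 1)
      + bvar i (j + n - 1) * dvar i (j - n + 1) * f (n - 1) (i + 1) j * f (n - 1) (i - 1) j"
begin

text \<open>The factor shared by all extensions of \<open>M\<close> on both surfaces. The face
  \<open>(i, j)\<close> is absent: its whole power belongs to the local factor.\<close>

definition common :: "side set \<Rightarrow> ratfun" where
  "common M =
     (\<Prod>x\<in>M. Var (label g x)) *
     (\<Prod>(k, l)\<in>P - near_faces i j. f (g k l) k l powi face_exponent g M k l) *
     f (n - 1) (i + 1) j powi face_exponent g M (i + 1) j *
     f (n - 1) i (j + 1) powi face_exponent g M i (j + 1) *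
     f (n - 1) (i - 1) j powi face_exponent g M (i - 1) j *
     f (n - 1) i (j - 1) powi face_exponent g M i (j - 1)"

lemma weight_extend:
  assumes "M \<inter> incident_sides i j = {}" "finite M" "config g (extend M s w u e)"
  shows "weight f P g (extend M s w u e) = common M *
    (cvar (i - n + 1) j ^ of_bool e * dvar i (j - n + 1) ^ of_bool u *
     avar (i + n - 1) j ^ of_bool w * bvar i (j + n - 1) ^ of_bool s
     * f n i j powi (1 - (of_bool e + of_bool u + of_bool w + of_bool s))
     * f (n - 1) (i + 1) j powi (- of_bool e) * f (n - 1) i (j + 1) powi (- of_bool u)
     * f (n - 1) (i - 1) j powi (- of_bool w) * f (n - 1) i (j - 1) powi (- of_bool s))"
proof -
  have faces: "(\<Prod>(k, l)\<in>P - near_faces i j. f (g k l) k l powi face_exponent g (extend M s w u e) k l) =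
      (\<Prod>(k, l)\<in>P - near_faces i j. f (g k l) k l powi face_exponent g M k l)"
    by (intro prod.cong refl) (auto simp: face_exponent_other(1)[folded near_faces_def])
  have nbrs_exponent:
    "face_exponent g (extend M s w u e) (i + 1) j = face_exponent g M (i + 1) j + (- of_bool e)"
    "face_exponent g (extend M s w u e) i (j + 1) = face_exponent g M i (j + 1) + (- of_bool u)"
    "face_exponent g (extend M s w u e) (i - 1) j = face_exponent g M (i - 1) j + (- of_bool w)"
    "face_exponent g (extend M s w u e) i (j - 1) = face_exponent g M i (j - 1) + (- of_bool s)"
    by (simp_all add: face_exponent_neighbour[OF assms(1,3)])
  show ?thesis
    unfolding weight_def common_def prod_extend[OF assms(1,2)] prod_near_faces[OF fin(2) sub(2)]
      faces prod.case face_exponent_center[OF assms(1)] nbrs_exponent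
      center nbrs label_inner avar_def bvar_def cvar_def dvar_def
      power_int_add[OF disjI1[OF nz(3)]] power_int_add[OF disjI1[OF nz(4)]]
      power_int_add[OF disjI1[OF nz(5)]] power_int_add[OF disjI1[OF nz(6)]]
    by (simp only: mult_ac)
qed

lemma weight_extend':
  assumes "M \<inter> incident_sides i j = {}" "finite M" "config g' (extend M s w u e)"
  shows "weight f P g' (extend M s w u e) = common M *
    (avar (i + n - 1) j ^ of_bool e * bvar i (j + n - 1) ^ of_bool u *
     cvar (i - n + 1) j ^ of_bool w * dvar i (j - n + 1) ^ of_bool s
     * f (n - 2) i j powi (1 - (of_bool e + of_bool u + of_bool w + of_bool s))
     * f (n - 1) (i + 1) j powi (1 - of_bool (cSE M) - of_bool (cNE M) - of_bool e)
     * f (n - 1) i (j + 1) powi (1 - of_bool (cNE M) - of_bool (cNW M) - of_bool u)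
     * f (n - 1) (i - 1) j powi (1 - of_bool (cNW M) - of_bool (cSW M) - of_bool w)
     * f (n - 1) i (j - 1) powi (1 - of_bool (cSW M) - of_bool (cSE M) - of_bool s))"
proof -
  have faces: "(\<Prod>(k, l)\<in>P - near_faces i j. f (g' k l) k l powi face_exponent g' (extend M s w u e) k l) =
      (\<Prod>(k, l)\<in>P - near_faces i j. f (g k l) k l powi face_exponent g M k l)"
  proof (intro prod.cong refl, safe)
    fix k l assume "(k, l) \<notin> near_faces i j"
    moreover from this have "g' k l = g k l"
      by (auto simp: g'_def near_faces_def)
    ultimately show "f (g' k l) k l powi face_exponent g' (extend M s w u e) k l =
        f (g k l) k l powi face_exponent g M k l"
      by (simp add: face_exponent_other(2)[folded near_faces_def])
  qed
  have labels: "(\<Prod>x\<in>M. Var (label g' x)) = (\<Prod>x\<in>M. Var (label g x))"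
    using assms(1) by (intro prod.cong refl) (simp add: label_outer disjoint_iff)
  have g': "g' i j = n - 2" "g' (i + 1) j = n - 1" "g' i (j + 1) = n - 1"
    "g' (i - 1) j = n - 1" "g' i (j - 1) = n - 1"
    by (simp_all add: g'_def nbrs)
  show ?thesis
    unfolding weight_def common_def prod_extend[OF assms(1,2)] prod_near_faces[OF fin(2) sub(2)]
      faces labels prod.case face_exponent_center[OF assms(1)] face_exponent_neighbour'[OF assms(1,3)]
      g' label_inner avar_def bvar_def cvar_def dvar_def
      power_int_add[OF disjI1[OF nz(3)]] power_int_add[OF disjI1[OF nz(4)]]
      power_int_add[OF disjI1[OF nz(5)]] power_int_add[OF disjI1[OF nz(6)]]
    by (simp only: mult_ac)
qed

text \<open>Group configurations by their sides \<open>M\<close> away from the face. Each group is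
  \<open>common M\<close> times one side of \<open>urban_renewal_identity\<close>, or is empty on
  both surfaces if \<open>rest_ok M\<close> fails.\<close>

theorem partition_sum_flip: "partition_sum f B P g' = partition_sum f B P g"
proof -
  have Z: "partition_sum f B P h =
      (\<Sum>M\<in>Pow (B - incident_sides i j). \<Sum>s\<in>UNIV. \<Sum>w\<in>UNIV. \<Sum>u\<in>UNIV. \<Sum>e\<in>UNIV.
         if config h (extend M s w u e) then weight f P h (extend M s w u e) else 0)" for h
  proof -
    have "partition_sum f B P h = (\<Sum>M\<in>Pow B. if config h M then weight f P h M else 0)"
      unfolding partition_sum_def using fin
      by (intro sum.mono_neutral_cong_left) auto
    thus ?thesis
      unfolding sum_Pow_extend[OF fin(1) sub(1)] .
  qed
  show ?thesis
    unfolding Z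
  proof (rule sum.cong[OF refl])
    fix M assume "M \<in> Pow (B - incident_sides i j)"
    hence M: "M \<inter> incident_sides i j = {}" "finite M"
      using fin by (auto intro: finite_subset)
    let ?LHS = "\<lambda>h. \<Sum>s\<in>UNIV. \<Sum>w\<in>UNIV. \<Sum>u\<in>UNIV. \<Sum>e\<in>UNIV.
      if config h (extend M s w u e) then weight f P h (extend M s w u e) else 0"
    show "?LHS g' = ?LHS g"
    proof (cases "rest_ok M")
      case False
      thus ?thesis
        by (simp add: config_extend[OF M(1)])
    next
      case True
      have pull: "(if b then common M * x else 0) = common M * (if b then x else 0)" for b x
        by simp
      have "?LHS g = (\<Sum>s\<in>UNIV. \<Sum>w\<in>UNIV. \<Sum>u\<in>UNIV. \<Sum>e\<in>UNIV.
        if config g (extend M s w u e) then common M *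
         (cvar (i - n + 1) j ^ of_bool e * dvar i (j - n + 1) ^ of_bool u *
          avar (i + n - 1) j ^ of_bool w * bvar i (j + n - 1) ^ of_bool s
          * f n i j powi (1 - (of_bool e + of_bool u + of_bool w + of_bool s))
          * f (n - 1) (i + 1) j powi (- of_bool e) * f (n - 1) i (j + 1) powi (- of_bool u)
          * f (n - 1) (i - 1) j powi (- of_bool w) * f (n - 1) i (j - 1) powi (- of_bool s)) else 0)"
        by (intro sum.cong refl if_cong weight_extend M)
      also have "\<dots> = (\<Sum>s\<in>UNIV. \<Sum>w\<in>UNIV. \<Sum>u\<in>UNIV. \<Sum>e\<in>UNIV.
        if config g' (extend M s w u e) then common M *
         (avar (i + n - 1) j ^ of_bool e * bvar i (j + n - 1) ^ of_bool u *
          cvar (i - n + 1) j ^ of_bool w * dvar i (j - n + 1) ^ of_bool s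
          * f (n - 2) i j powi (1 - (of_bool e + of_bool u + of_bool w + of_bool s))
          * f (n - 1) (i + 1) j powi (1 - of_bool (cSE M) - of_bool (cNE M) - of_bool e)
          * f (n - 1) i (j + 1) powi (1 - of_bool (cNE M) - of_bool (cNW M) - of_bool u)
          * f (n - 1) (i - 1) j powi (1 - of_bool (cNW M) - of_bool (cSW M) - of_bool w)
          * f (n - 1) i (j - 1) powi (1 - of_bool (cSW M) - of_bool (cSE M) - of_bool s)) else 0)"
        unfolding pull sum_distrib_left[symmetric] config_extend[OF M(1)] simp_thms eqTrueI[OF True]
        by (rule arg_cong[where f = "(*) (common M)"], rule urban_renewal_identity)
           (use nz rec in simp_all)
      also have "\<dots> = ?LHS g'"
        by (intro sum.cong refl if_cong weight_extend'[symmetric] M)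
      finally show ?thesis ..
    qed
  qed
qed

end

end

section \<open>Configurations of the cone below the target\<close>

definition cone :: "int \<Rightarrow> int \<Rightarrow> int \<Rightarrow> int \<Rightarrow> int \<Rightarrow> int" where
  "cone n0 i0 j0 = (\<lambda>i j. n0 - \<bar>i - i0\<bar> - \<bar>j - j0\<bar>)"

lemma step_height_cone:
  assumes "even (n0 + i0 + j0)"
  shows "step_height (cone n0 i0 j0)"
  unfolding step_height_def cone_def
proof (intro allI conjI)
  fix i j
  show "\<bar>n0 - \<bar>i + 1 - i0\<bar> - \<bar>j - j0\<bar> - (n0 - \<bar>i - i0\<bar> - \<bar>j - j0\<bar>)\<bar> = 1"
    "\<bar>n0 - \<bar>i - i0\<bar> - \<bar>j + 1 - j0\<bar> - (n0 - \<bar>i - i0\<bar> - \<bar>j - j0\<bar>)\<bar> = 1"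
    by linarith+
  show "even (n0 - \<bar>i - i0\<bar> - \<bar>j - j0\<bar> + i + j)"
    using assms by presburger
qed

text \<open>
  Every side of a configuration is followed by one farther away from the apex, so a finite
  configuration is empty.
\<close>

lemma config_cone_imp_empty:
  assumes cfg: "config (cone n0 i0 j0) M" and "finite M"
  shows "M = {}"
proof (rule ccontr)
  assume "M \<noteq> {}"
  \<comment> \<open>Twice the taxicab distance from the apex to the midpoint of the side.\<close>
  define \<rho> :: "side \<Rightarrow> int" where
    "\<rho> = (\<lambda>x. case x of Hor i j \<Rightarrow> \<bar>2 * i + 1 - 2 * i0\<bar> + 2 * \<bar>j - j0\<bar>
                    | Ver i j \<Rightarrow> 2 * \<bar>i - i0\<bar> + \<bar>2 * j + 1 - 2 * j0\<bar>)"
  have sq: "square_ok (cone n0 i0 j0) M i j" for i j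
    using cfg by (simp add: config_def)
  have NE: "Hor i (j + 1) \<in> M \<or> Ver (i + 1) j \<in> M"
    if "i0 \<le> i" "j0 \<le> j" "Hor i j \<in> M \<or> Ver i j \<in> M" for i j
    using sq[of i j] that by (auto simp: square_ok_def cone_def of_bool_def split: if_splits)
  have SW: "Hor i j \<in> M \<or> Ver i j \<in> M"
    if "i < i0" "j < j0" "Hor i (j + 1) \<in> M \<or> Ver (i + 1) j \<in> M" for i j
    using sq[of i j] that by (auto simp: square_ok_def cone_def of_bool_def split: if_splits)
  have SE: "Hor i j \<in> M \<or> Ver (i + 1) j \<in> M"
    if "i0 \<le> i" "j < j0" "Hor i (j + 1) \<in> M \<or> Ver i j \<in> M" for i j
    using sq[of i j] that by (auto simp: square_ok_def cone_def of_bool_def split: if_splits)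
  have NW: "Hor i (j + 1) \<in> M \<or> Ver i j \<in> M"
    if "i < i0" "j0 \<le> j" "Hor i j \<in> M \<or> Ver (i + 1) j \<in> M" for i j
    using sq[of i j] that by (auto simp: square_ok_def cone_def of_bool_def split: if_splits)
  have "\<exists>y\<in>M. \<rho> y > \<rho> x" if "x \<in> M" for x
  proof (cases x)
    case (Hor i j)
    consider "i0 \<le> i" "j0 \<le> j" | "i0 \<le> i" "j < j0" | "i < i0" "j0 \<le> j" | "i < i0" "j < j0"
      by linarith
    thus ?thesis
    proof cases
      case 1
      hence "Hor i (j + 1) \<in> M \<or> Ver (i + 1) j \<in> M"
        using NE[of i j] that Hor by auto
      thus ?thesis
        using 1 by (elim disjE) (auto simp: \<rho>_def Hor intro: rev_bexI)
    next
      case 2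
      hence "Hor i (j - 1) \<in> M \<or> Ver (i + 1) (j - 1) \<in> M"
        using SE[of i "j - 1"] that Hor by auto
      thus ?thesis
        using 2 by (elim disjE) (auto simp: \<rho>_def Hor intro: rev_bexI)
    next
      case 3
      hence "Hor i (j + 1) \<in> M \<or> Ver i j \<in> M"
        using NW[of i j] that Hor by auto
      thus ?thesis
        using 3 by (elim disjE) (auto simp: \<rho>_def Hor intro: rev_bexI)
    next
      case 4
      hence "Hor i (j - 1) \<in> M \<or> Ver i (j - 1) \<in> M"
        using SW[of i "j - 1"] that Hor by auto
      thus ?thesis
        using 4 by (elim disjE) (auto simp: \<rho>_def Hor intro: rev_bexI)
    qed
  next
    case (Ver i j)
    consider "i0 \<le> i" "j0 \<le> j" | "i0 \<le> i" "j < j0" | "i < i0" "j0 \<le> j" | "i < i0" "j < j0"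
      by linarith
    thus ?thesis
    proof cases
      case 1
      hence "Hor i (j + 1) \<in> M \<or> Ver (i + 1) j \<in> M"
        using NE[of i j] that Ver by auto
      thus ?thesis
        using 1 by (elim disjE) (auto simp: \<rho>_def Ver intro: rev_bexI)
    next
      case 2
      hence "Hor i j \<in> M \<or> Ver (i + 1) j \<in> M"
        using SE[of i j] that Ver by auto
      thus ?thesis
        using 2 by (elim disjE) (auto simp: \<rho>_def Ver intro: rev_bexI)
    next
      case 3
      hence "Hor (i - 1) (j + 1) \<in> M \<or> Ver (i - 1) j \<in> M"
        using NW[of "i - 1" j] that Ver by auto
      thus ?thesis
        using 3 by (elim disjE) (auto simp: \<rho>_def Ver intro: rev_bexI)
    next
      case 4
      hence "Hor (i - 1) j \<in> M \<or> Ver (i - 1) j \<in> M"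
        using SW[of "i - 1" j] that Ver by auto
      thus ?thesis
        using 4 by (elim disjE) (auto simp: \<rho>_def Ver intro: rev_bexI)
    qed
  qed
  moreover have "Max (\<rho> ` M) \<in> \<rho> ` M"
    using \<open>finite M\<close> \<open>M \<noteq> {}\<close> by (intro Max_in) auto
  then obtain x where "x \<in> M" and x: "\<rho> x = Max (\<rho> ` M)"
    by (metis imageE)
  moreover have "\<rho> y \<le> \<rho> x" if "y \<in> M" for y
    unfolding x using \<open>finite M\<close> that by simp
  ultimately show False
    by (meson not_less)
qed

lemma config_cone_empty: "config (cone n0 i0 j0) {}"
  by (auto simp: config_def square_ok_def cone_def)

text \<open>The apex has no wrenches, which leaves exponent 1. Every other face has exactly two,
  both matched: they add 1 as edges and subtract 2 as matched edges.\<close>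

lemma face_exponent_cone: "face_exponent (cone n0 i0 j0) {} k l = of_bool (k = i0 \<and> l = j0)"
proof -
  have "i0 < k \<or> i0 = k \<or> k < i0" "j0 < l \<or> j0 = l \<or> l < j0"
    by linarith+
  thus ?thesis
    by (elim disjE) (simp_all add: face_exponent_def wrench_matched_def cone_def)
qed

lemma partition_sum_cone:
  assumes "finite B" "finite P" "(i0, j0) \<in> P"
  shows "partition_sum f B P (cone n0 i0 j0) = f n0 i0 j0"
proof -
  have "{M. M \<subseteq> B \<and> config (cone n0 i0 j0) M} = {{}}"
    using assms(1) config_cone_imp_empty config_cone_empty finite_subset by blast
  hence "partition_sum f B P (cone n0 i0 j0) =
      (\<Prod>(k, l)\<in>P. f (cone n0 i0 j0 k l) k l powi of_bool (k = i0 \<and> l = j0))"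
    by (simp add: partition_sum_def weight_def face_exponent_cone)
  also have "\<dots> = (\<Prod>p\<in>P. if p = (i0, j0) then f n0 i0 j0 else 1)"
  proof (intro prod.cong refl, safe)
    fix k l
    show "f (cone n0 i0 j0 k l) k l powi of_bool (k = i0 \<and> l = j0) =
        (if (k, l) = (i0, j0) then f n0 i0 j0 else 1)"
      by (cases "k = i0 \<and> l = j0") (auto simp: cone_def)
  qed
  also have "\<dots> = f n0 i0 j0"
    using assms by simp
  finally show ?thesis .
qed

section \<open>Lowering the cone to the initial surface\<close>

lemma octahedron_nonzero:
  assumes "height_function h" "(n, i, j) \<in> initial_set h \<union> upper_set h"
  shows "octahedron h n i j \<noteq> 0"
  using assms by (intro pos_ratfuns_nonzero octahedron_pos octahedron_dom_height)

text \<open>Where the cone lies below \<open>h\<close>, the surface \<open>min h C\<close> leaves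
  the domain of \<open>f\<close>; the default value of \<open>octahedron\<close> there keeps all
  weights Laurent monomials.\<close>

lemma octahedron_below:
  assumes "n \<le> h i j"
  shows "octahedron h n i j = xvar i j"
proof -
  have "octahedron_dom (h, n, i, j)"
    using assms by (auto intro: octahedron.domintros)
  thus ?thesis
    using assms by (simp add: octahedron.psimps)
qed

lemma height_function_step:
  assumes "height_function h"
  shows "step_height h"
  unfolding step_height_def
proof (intro allI conjI)
  fix i j
  have *: "\<bar>h i1 j1 - h i2 j2\<bar> = 1" if "\<bar>i1 - i2\<bar> + \<bar>j1 - j2\<bar> = 1" for i1 i2 j1 j2
    using assms that unfolding height_function_def by blast
  show "\<bar>h (i + 1) j - h i j\<bar> = 1" "\<bar>h i (j + 1) - h i j\<bar> = 1"
    by (rule *, simp)+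
  have "[h i j = i + j] (mod 2)"
    using assms unfolding height_function_def by blast
  thus "even (h i j + i + j)"
    unfolding cong_iff_dvd_diff by presburger
qed

text \<open>By parity the two surfaces agree or differ by at least 2, so they cannot cross strictly
  between neighbouring points.\<close>

lemma step_height_min:
  assumes "step_height g" "step_height h"
  shows "step_height (\<lambda>i j. min (g i j) (h i j))"
  unfolding step_height_def
proof (intro allI conjI)
  fix i j
  have g: "\<bar>g (i + 1) j - g i j\<bar> = 1" "\<bar>g i (j + 1) - g i j\<bar> = 1" "even (g i j + i + j)"
    and h: "\<bar>h (i + 1) j - h i j\<bar> = 1" "\<bar>h i (j + 1) - h i j\<bar> = 1" "even (h i j + i + j)"
    using assms by (auto simp: step_height_def)
  have gap: "g i j = h i j \<or> g i j + 2 \<le> h i j \<or> h i j + 2 \<le> g i j"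
    using g(3) h(3) by presburger
  show "even (min (g i j) (h i j) + i + j)"
    using g h by (simp add: min_def)
  show "\<bar>min (g (i + 1) j) (h (i + 1) j) - min (g i j) (h i j)\<bar> = 1"
    "\<bar>min (g i (j + 1)) (h i (j + 1)) - min (g i j) (h i j)\<bar> = 1"
    using g(1,2) h(1,2) gap by (auto simp: min_def)
qed

lemma finite_below_cone:
  assumes "height_function h"
  shows "finite {(k, l). h k l < cone n0 i0 j0 k l}"
proof -
  \<comment> \<open>By the triangle inequality, the cone plus the taxicab norm never exceeds this
    value.\<close>
  define N where "N = n0 + \<bar>i0\<bar> + \<bar>j0\<bar>"
  have "filterlim (\<lambda>(i, j). h i j + \<bar>i\<bar> + \<bar>j\<bar>) at_top
          (filtercomap (\<lambda>(i, j). \<bar>i\<bar> + \<bar>j\<bar>) at_top)"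
    using assms by (simp add: height_function_def)
  hence "\<forall>\<^sub>F p in filtercomap (\<lambda>(i, j). \<bar>i\<bar> + \<bar>j\<bar>) at_top.
           (case p of (i, j) \<Rightarrow> h i j + \<bar>i\<bar> + \<bar>j\<bar>) \<ge> N"
    unfolding filterlim_at_top by blast
  then obtain K where K: "\<And>i j. \<bar>i\<bar> + \<bar>j\<bar> \<ge> K \<Longrightarrow> h i j + \<bar>i\<bar> + \<bar>j\<bar> \<ge> N"
    unfolding eventually_filtercomap eventually_at_top_linorder by fastforce
  have "{(k, l). h k l < cone n0 i0 j0 k l} \<subseteq> {-\<bar>K\<bar>..\<bar>K\<bar>} \<times> {-\<bar>K\<bar>..\<bar>K\<bar>}"
  proof safe
    fix k l assume "h k l < cone n0 i0 j0 k l"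
    hence "h k l + \<bar>k\<bar> + \<bar>l\<bar> < N"
      unfolding cone_def N_def by linarith
    hence "\<bar>k\<bar> + \<bar>l\<bar> < K"
      using K[of k l] by linarith
    thus "k \<in> {-\<bar>K\<bar>..\<bar>K\<bar>}" "l \<in> {-\<bar>K\<bar>..\<bar>K\<bar>}"
      by auto
  qed
  thus ?thesis
    by (rule finite_subset) simp
qed

text \<open>Induction on the total gap to the cone. A lowest point of \<open>g\<close> among those
  strictly below the cone is a local minimum of \<open>g\<close>, so \<open>g\<close> can be raised
  by 2 there.\<close>

lemma partition_sum_between:
  fixes h g :: "int \<Rightarrow> int \<Rightarrow> int" and n0 i0 j0 :: int
  defines "D \<equiv> {(k, l). h k l < cone n0 i0 j0 k l}"
  assumes h: "height_function h" and apex: "even (n0 + i0 + j0)" and "finite B" "finite P" and "(i0, j0) \<in> P"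
    and B: "\<And>k l. (k, l) \<in> D \<Longrightarrow> incident_sides k l \<subseteq> B"
    and P: "\<And>k l. (k, l) \<in> D \<Longrightarrow> near_faces k l \<subseteq> P"
    and "step_height g" "\<And>k l. min (h k l) (cone n0 i0 j0 k l) \<le> g k l" "\<And>k l. g k l \<le> cone n0 i0 j0 k l"
  shows "partition_sum (octahedron h) B P g = octahedron h n0 i0 j0"
  using assms(9-11)
proof (induction "\<Sum>(k, l)\<in>D. nat (cone n0 i0 j0 k l - g k l)" arbitrary: g rule: less_induct)
  case less
  let ?C = "cone n0 i0 j0"
  have "finite D"
    unfolding D_def by (rule finite_below_cone[OF h])
  define E where "E = {(k, l). g k l < ?C k l}"
  have below: "h k l \<le> g k l" if "(k, l) \<in> E" for k l
    using less.prems(2)[of k l] that unfolding E_def by auto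
  have "E \<subseteq> D"
    using below unfolding D_def E_def by fastforce
  hence "finite E"
    using \<open>finite D\<close> finite_subset by blast
  note steps = step_heightD[OF less.prems(1)]
  show ?case
  proof (cases "E = {}")
    case True
    hence "g = ?C"
      using less.prems(3) by (intro ext antisym) (auto simp: E_def not_less)
    thus ?thesis
      using assms by (simp add: partition_sum_cone)
  next
    case False
    obtain p where "p \<in> E" and p: "\<And>q. q \<in> E \<Longrightarrow> case_prod g p \<le> case_prod g q"
      using \<open>finite E\<close> False by (metis arg_min_if_finite(1) arg_min_least)
    obtain i j where ij: "p = (i, j)"
      by (cases p)
    have E: "(i, j) \<in> E"
      using \<open>p \<in> E\<close> by (simp add: ij)
    have min: "g i j \<le> g k l" if "(k, l) \<in> E" for k l
      using p[OF that] by (simp add: ij)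
    define n where "n = g i j + 2"
    define g2 where "g2 = (\<lambda>k l. if k = i \<and> l = j then n else g k l)"
    \<comment> \<open>A lower neighbour could not be in \<open>E\<close> by minimality, so it would
      lie on the cone; the cone would then be no higher than \<open>g\<close> at
      \<open>(i, j)\<close>.\<close>
    have up: "g k l = g i j + 1" if "\<bar>k - i\<bar> + \<bar>l - j\<bar> = 1" for k l
    proof -
      have kl: "(k = i + 1 \<and> l = j) \<or> (k = i - 1 \<and> l = j) \<or> (k = i \<and> l = j + 1) \<or> (k = i \<and> l = j - 1)"
        using that by linarith
      hence "\<bar>g k l - g i j\<bar> = 1"
        using steps[of i j] by (elim disjE) auto
      moreover have "g k l \<noteq> g i j - 1"
      proof
        assume *: "g k l = g i j - 1"
        hence "(k, l) \<notin> E"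
          using min[of k l] by auto
        hence "?C k l \<le> g i j - 1"
          using * less.prems(3)[of k l] by (auto simp: E_def)
        moreover have "?C i j \<le> ?C k l + 1"
          using kl step_heightD[OF step_height_cone[OF apex], of i j] by (elim disjE) auto
        ultimately show False
          using E by (simp add: E_def)
      qed
      ultimately show ?thesis
        by linarith
    qed
    have nb: "g (i + 1) j = n - 1" "g i (j + 1) = n - 1" "g (i - 1) j = n - 1" "g i (j - 1) = n - 1"
      by (simp_all add: up n_def)
    have sh2: "step_height g2"
      unfolding step_height_def
    proof (intro allI conjI)
      fix k l
      show "\<bar>g2 (k + 1) l - g2 k l\<bar> = 1"
        using steps(1)[of k l] nb by (auto simp: g2_def)
      show "\<bar>g2 k (l + 1) - g2 k l\<bar> = 1"
        using steps(2)[of k l] nb by (auto simp: g2_def)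
      show "even (g2 k l + k + l)"
        using steps(3)[of k l] by (auto simp: g2_def n_def)
    qed
    \<comment> \<open>Flips lower a surface, so the raised \<open>g2\<close> is the starting surface
      and \<open>g\<close> is recovered as \<open>g'\<close>.\<close>
    interpret local_flip g2 i j n
      by unfold_locales (use sh2 nb in \<open>auto simp: g2_def\<close>)
    have "g' = g"
      unfolding g'_def by (auto simp: g2_def n_def fun_eq_iff)
    \<comment> \<open>Equal parity ensures that raising by 2 does not overshoot the cone.\<close>
    have "even (?C i j - g i j)"
      using steps(3)[of i j] step_heightD(3)[OF step_height_cone[OF apex], of i j] by presburger
    hence "n \<le> ?C i j"
      using E unfolding E_def n_def mem_Collect_eq prod.case by presburger
    have upper: "(n, i, j) \<in> upper_set h"
      using below[OF E] steps(3)[of i j]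
      by (auto simp: upper_set_def lattice_def n_def cong_iff_dvd_diff)
    note pre = octahedron_predecessors[OF h upper]
    note nz = octahedron_nonzero[OF h]
    have "(i, j) \<in> D"
      using E \<open>E \<subseteq> D\<close> by blast
    have "partition_sum (octahedron h) B P g' = partition_sum (octahedron h) B P g2"
    proof (rule partition_sum_flip[OF \<open>finite B\<close> \<open>finite P\<close> B P])
      show "octahedron h n i j * octahedron h (n - 2) i j =
        avar (i + n - 1) j * cvar (i - n + 1) j * octahedron h (n - 1) i (j + 1) * octahedron h (n - 1) i (j - 1)
        + bvar i (j + n - 1) * dvar i (j - n + 1) * octahedron h (n - 1) (i + 1) j * octahedron h (n - 1) (i - 1) j"
        using nz[OF pre(5)] by (simp add: octahedron_upper[OF h upper])
    qed (use \<open>(i, j) \<in> D\<close> upper in \<open>auto intro!: nz pre\<close>)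
    also have "\<dots> = octahedron h n0 i0 j0"
    proof (rule less.hyps)
      show "(\<Sum>(k, l)\<in>D. nat (?C k l - g2 k l)) < (\<Sum>(k, l)\<in>D. nat (?C k l - g k l))"
        by (rule sum_strict_mono_ex1)
           (use \<open>finite D\<close> \<open>(i, j) \<in> D\<close> \<open>n \<le> ?C i j\<close> in \<open>auto simp: g2_def n_def intro!: bexI[of _ "(i, j)"]\<close>)
      show "step_height g2"
        by (rule sh2)
      show "min (h k l) (?C k l) \<le> g2 k l" for k l
        using less.prems(2)[of k l] by (auto simp: g2_def n_def)
      show "g2 k l \<le> ?C k l" for k l
        using less.prems(3)[of k l] \<open>n \<le> ?C i j\<close> by (auto simp: g2_def)
    qed
    finally show ?thesis
      unfolding \<open>g' = g\<close> .
  qed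
qed

section \<open>Exponents and labels\<close>

text \<open>Here \<open>x\<close> and \<open>y\<close> are the two sides of a face at one of its
  corners. Without a wrench on that face they share a vertex, so at most one is used; with a wrench
  both may be used, but neither if it is matched.\<close>

lemma corner_bound:
  assumes "x \<in> {Hor k l, Ver k l, Hor k (l + 1), Ver (k + 1) l}"
    and "y \<in> {Hor k l, Ver k l, Hor k (l + 1), Ver (k + 1) l}"
    and "m = m' \<Longrightarrow> \<not> (x \<in> M \<and> y \<in> M)"
  shows "of_bool (x \<in> M) + of_bool (y \<in> M) + 2 * wrench_matched M k l m m' \<le> 1 + of_bool (m \<noteq> m')"
proof (cases "wrench_matched M k l m m' = 0")
  case True
  thus ?thesis
    using assms(3) by (cases "x \<in> M"; cases "y \<in> M"; cases "m = m'"; simp)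
next
  case False
  hence "m \<noteq> m'" "Hor k l \<notin> M" "Ver k l \<notin> M" "Hor k (l + 1) \<notin> M" "Ver (k + 1) l \<notin> M"
    by (simp_all add: wrench_matched_def)
  moreover from this have "x \<notin> M" "y \<notin> M"
    using assms(1,2) by blast+
  ultimately show ?thesis
    by (simp add: wrench_matched_def)
qed

text \<open>The four parts concern the face at the lower left, lower right, upper right and upper
  left corner of the square.\<close>

lemma square_ok_corner:
  assumes "square_ok g M k l"
  shows "g (k + 1) l = g k (l + 1) \<Longrightarrow> \<not> (Hor k l \<in> M \<and> Ver k l \<in> M)"
    and "g k l = g (k + 1) (l + 1) \<Longrightarrow> \<not> (Ver (k + 1) l \<in> M \<and> Hor k l \<in> M)"
    and "g (k + 1) l = g k (l + 1) \<Longrightarrow> \<not> (Hor k (l + 1) \<in> M \<and> Ver (k + 1) l \<in> M)"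
    and "g k l = g (k + 1) (l + 1) \<Longrightarrow> \<not> (Ver k l \<in> M \<and> Hor k (l + 1) \<in> M)"
  using assms unfolding square_ok_def
  by (cases "Hor k l \<in> M"; cases "Ver k l \<in> M"; cases "Hor k (l + 1) \<in> M";
      cases "Ver (k + 1) l \<in> M"; simp split: if_splits)+

text \<open>
  Twice the exponent is the sum over the four corners of the face of \<open>1/2\<close>, minus the sides
  at that corner, plus the excess of unmatched over matched wrenches; each side meets two corners.
\<close>

lemma face_exponent_bounds:
  assumes g: "step_height g" and cfg: "config g M"
  shows "- 1 \<le> face_exponent g M i j" "face_exponent g M i j \<le> 3"
proof -
  let ?E = "g (i + 1) j" and ?N = "g i (j + 1)" and ?W = "g (i - 1) j" and ?S = "g i (j - 1)"
  have sq: "square_ok g M k l" for k l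
    using cfg by (simp add: config_def)
  have NE: "hor M i j + ver M i j + 2 * wrench_matched M i j ?E ?N \<le> 1 + of_bool (?E \<noteq> ?N)"
    using square_ok_corner(1)[OF sq, of i j] by (intro corner_bound) auto
  have NW: "ver M i j + hor M (i - 1) j + 2 * wrench_matched M (i - 1) j ?N ?W \<le> 1 + of_bool (?N \<noteq> ?W)"
    using square_ok_corner(2)[OF sq, of "i - 1" j] by (intro corner_bound) auto
  have SW: "hor M (i - 1) j + ver M i (j - 1) + 2 * wrench_matched M (i - 1) (j - 1) ?W ?S \<le> 1 + of_bool (?W \<noteq> ?S)"
    using square_ok_corner(3)[OF sq, of "i - 1" "j - 1"] by (intro corner_bound) auto
  have SE: "ver M i (j - 1) + hor M i j + 2 * wrench_matched M i (j - 1) ?S ?E \<le> 1 + of_bool (?S \<noteq> ?E)"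
    using square_ok_corner(4)[OF sq, of i "j - 1"] by (intro corner_bound) auto
  have "?E = g i j + 1 \<or> ?E = g i j - 1" "?N = g i j + 1 \<or> ?N = g i j - 1"
    "?W = g i j + 1 \<or> ?W = g i j - 1" "?S = g i j + 1 \<or> ?S = g i j - 1"
    using step_heightD[OF g, of i j] by linarith+
  \<comment> \<open>The four heights around a face take at most two values, so in cyclic order
    ascents and descents alternate and are equally many.\<close>
  hence asc: "2 * (of_bool (?E < ?N) + of_bool (?N < ?W) + of_bool (?W < ?S) + of_bool (?S < ?E)) =
      of_bool (?E \<noteq> ?N) + of_bool (?N \<noteq> ?W) + of_bool (?W \<noteq> ?S) + (of_bool (?S \<noteq> ?E) :: int)"
    by (elim disjE) simp_all
  have lower: "- 1 \<le> 1 - (a + b + c + d) + p + q + r + t - w1 - w2 - w3 - w4"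
    if "a + c + 2 * w1 \<le> 1 + e1" "c + b + 2 * w2 \<le> 1 + e2" "b + d + 2 * w3 \<le> 1 + e3"
      "d + a + 2 * w4 \<le> 1 + e4" "2 * (p + q + r + t) = e1 + e2 + e3 + e4"
    for a b c d e1 e2 e3 e4 p q r t w1 w2 w3 w4 :: int
    using that by smt
  show "- 1 \<le> face_exponent g M i j"
    unfolding face_exponent_def by (rule lower[OF NE NW SW SE asc])
  \<comment> \<open>At most two of the four cyclic steps ascend, which gives 1 + 2.\<close>
  have upper: "1 - (a + b + c + d) + p + q + r + t - w1 - w2 - w3 - w4 \<le> 3"
    if "2 * (p + q + r + t) = e1 + e2 + e3 + e4" "e1 \<le> 1" "e2 \<le> 1" "e3 \<le> 1" "e4 \<le> 1"
      "0 \<le> a" "0 \<le> b" "0 \<le> c" "0 \<le> d" "0 \<le> w1" "0 \<le> w2" "0 \<le> w3" "0 \<le> w4"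
    for a b c d e1 e2 e3 e4 p q r t w1 w2 w3 w4 :: int
    using that by smt
  show "face_exponent g M i j \<le> 3"
    unfolding face_exponent_def by (rule upper[OF asc]) (simp_all add: wrench_matched_def)
qed

section \<open>Distinctness of the labels\<close>

lemma Abs_edge_eq_iff:
  assumes "odd (i + j)" "odd (k + l)"
  shows "Abs_edge (i, j) = Abs_edge (k, l) \<longleftrightarrow> i = k \<and> j = l"
  using assms by (subst Abs_edge_inject) auto

lemma unit_steps_mono:
  fixes u :: "int \<Rightarrow> int"
  assumes "\<And>k. u k \<le> u (k + 1)" "k \<le> l"
  shows "u k \<le> u l"
  using assms(2)
proof (induction l rule: int_ge_induct)
  case (step l)
  thus ?case
    using assms(1)[of l] by linarith
qed simp

lemma inj_if_jump:
  fixes u :: "int \<Rightarrow> int"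
  assumes mono: "\<And>k. u k \<le> u (k + 1)" and "u k = u l" "u k < u (k + 1)" "u l < u (l + 1)"
  shows "k = l"
proof (rule linorder_cases[of k l])
  assume "k < l"
  hence "u (k + 1) \<le> u l"
    using unit_steps_mono[of u, OF mono] by simp
  thus ?thesis using assms by simp
next
  assume "l < k"
  hence "u (l + 1) \<le> u k"
    using unit_steps_mono[of u, OF mono] by simp
  thus ?thesis using assms by simp
qed

text \<open>The sums and differences behind the labels are monotone along each line, so each odd
  value is jumped over at most once.\<close>

lemma inj_label:
  assumes g: "step_height g"
  shows "inj (label g)"
proof
  fix x y assume eq: "label g x = label g y"
  note s = step_heightD[OF g]
  have rows: "k + g k j \<le> k + 1 + g (k + 1) j" "k - g k j \<le> k + 1 - g (k + 1) j" for k j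
    using s(1)[of k j] by linarith+
  have cols: "k + g i k \<le> k + 1 + g i (k + 1)" "k - g i k \<le> k + 1 - g i (k + 1)" for k i
    using s(2)[of i k] by linarith+
  have odds: "odd (i + g i j + 1 + j)" "odd (i - g (i + 1) j + j)" "odd (i + (j + g i j + 1))"
    "odd (i + (j - g i (j + 1)))" for i j
    using s(3)[of i j] s(3)[of "i + 1" j] s(3)[of i "j + 1"] by presburger+
  note edge_eq = Abs_edge_eq_iff[OF odds(1) odds(1)] Abs_edge_eq_iff[OF odds(2) odds(2)]
    Abs_edge_eq_iff[OF odds(3) odds(3)] Abs_edge_eq_iff[OF odds(4) odds(4)]
  show "x = y"
  proof (cases x; cases y)
    fix i j k l assume xy: "x = Hor i j" "y = Hor k l"
    show ?thesis
    proof (cases "g i j < g (i + 1) j")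
      case True
      hence "l = j" "i + g i j = k + g k j" "g k j < g (k + 1) j"
        using eq xy by (auto simp: edge_eq split: if_splits)
      thus ?thesis
        using inj_if_jump[of "\<lambda>i. i + g i j", OF rows(1), of i k] True xy by auto
    next
      case False
      hence *: "l = j" "i - g (i + 1) j = k - g (k + 1) j" "\<not> g k j < g (k + 1) j"
        using eq xy by (auto simp: edge_eq split: if_splits)
      hence "g (i + 1) j = g i j - 1" "g (k + 1) j = g k j - 1"
        using False s(1)[of i j] s(1)[of k j] by linarith+
      thus ?thesis
        using inj_if_jump[of "\<lambda>i. i - g i j", OF rows(2), of i k] * xy by auto
    qed
  next
    fix i j k l assume xy: "x = Ver i j" "y = Ver k l"
    show ?thesis
    proof (cases "g i j < g i (j + 1)")
      case True
      hence "k = i" "j + g i j = l + g i l" "g i l < g i (l + 1)"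
        using eq xy by (auto simp: edge_eq split: if_splits)
      thus ?thesis
        using inj_if_jump[of "\<lambda>j. j + g i j", OF cols(1), of j l] True xy by auto
    next
      case False
      hence *: "k = i" "j - g i (j + 1) = l - g i (l + 1)" "\<not> g i l < g i (l + 1)"
        using eq xy by (auto simp: edge_eq split: if_splits)
      hence "g i (j + 1) = g i j - 1" "g i (l + 1) = g i l - 1"
        using False s(2)[of i j] s(2)[of i l] by linarith+
      thus ?thesis
        using inj_if_jump[of "\<lambda>j. j - g i j", OF cols(2), of j l] * xy by auto
    qed
  qed (use eq in \<open>auto split: if_splits\<close>)
qed

lemma label_not_face: "\<not> is_face (label g x)"
  by (cases x) auto

section \<open>The Laurent expansion\<close>

definition exponent_vector ::
  "(int \<times> int) set \<Rightarrow> (int \<Rightarrow> int \<Rightarrow> int) \<Rightarrow> side set \<Rightarrow> var \<Rightarrow>\<^sub>0 int" where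
  "exponent_vector P g M =
     (\<Sum>x\<in>M. Poly_Mapping.single (label g x) 1) +
     (\<Sum>(k, l)\<in>P. Poly_Mapping.single (Face k l) (face_exponent g M k l))"

lemma laurent_monomial_exponent_vector:
  assumes "\<And>k l. f (g k l) k l = xvar k l"
  shows "laurent_monomial (exponent_vector P g M) = weight f P g M"
  by (simp add: exponent_vector_def weight_def laurent_monomial_add laurent_monomial_sum
      laurent_monomial_single assms xvar_def case_prod_unfold)

lemma lookup_exponent_vector_face:
  assumes "finite P"
  shows "Poly_Mapping.lookup (exponent_vector P g M) (Face k l) =
    (if (k, l) \<in> P then face_exponent g M k l else 0)"
proof -
  have "(\<Sum>x\<in>M. Poly_Mapping.lookup (Poly_Mapping.single (label g x) (1::int)) (Face k l)) = 0"
    using label_not_face by (intro sum.neutral) (metis lookup_single_not_eq var.disc(1))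
  moreover have "(\<Sum>p\<in>P. Poly_Mapping.lookup (case p of (k, l) \<Rightarrow>
        Poly_Mapping.single (Face k l) (face_exponent g M k l)) (Face k l)) =
      (\<Sum>p\<in>P. if p = (k, l) then face_exponent g M k l else 0)"
    by (intro sum.cong refl) (auto simp: lookup_single when_def split: if_splits)
  ultimately show ?thesis
    using assms by (simp add: exponent_vector_def lookup_add lookup_sum)
qed

text \<open>Distinct sides contribute distinct edge variables, so no exponent accumulates beyond
  1.\<close>

lemma lookup_exponent_vector_edge:
  assumes "step_height g" "finite M" "\<not> is_face v"
  shows "Poly_Mapping.lookup (exponent_vector P g M) v = of_bool (v \<in> label g ` M)"
proof -
  have "(\<Sum>p\<in>P. Poly_Mapping.lookup (case p of (k, l) \<Rightarrow>
        Poly_Mapping.single (Face k l) (face_exponent g M k l)) v) = 0"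
    using assms(3) by (intro sum.neutral) (auto simp: lookup_single when_def)
  moreover have "(\<Sum>x\<in>M. Poly_Mapping.lookup (Poly_Mapping.single (label g x) 1) v) =
      (\<Sum>w\<in>label g ` M. if v = w then 1 else 0 :: int)"
    by (subst sum.reindex) (use inj_label[OF assms(1)] in \<open>auto simp: inj_on_def lookup_single when_def o_def inj_def\<close>)
  ultimately show ?thesis
    using assms by (simp add: exponent_vector_def lookup_add lookup_sum)
qed

text \<open>The edge variables alone recover \<open>M\<close>; the face exponents are not
  consulted.\<close>

lemma inj_on_exponent_vector:
  assumes "step_height g"
  shows "inj_on (exponent_vector P g) {M. finite M}"
proof
  fix M M' assume "M \<in> {M. finite M}" "M' \<in> {M. finite M}"
    and eq: "exponent_vector P g M = exponent_vector P g M'"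
  hence fin: "finite M" "finite M'"
    by auto
  have "label g x \<in> label g ` M \<longleftrightarrow> label g x \<in> label g ` M'" for x
    using lookup_exponent_vector_edge[OF assms fin(1) label_not_face, where P = P]
      lookup_exponent_vector_edge[OF assms fin(2) label_not_face, where P = P] eq
    by (metis of_bool_eq_iff)
  thus "M = M'"
    using inj_label[OF assms] by (auto simp: inj_image_mem_iff)
qed

theorem mainTheorem1:
  fixes h :: "int \<Rightarrow> int \<Rightarrow> int" and n i j :: int
  assumes "height_function h" and "(n, i, j) \<in> upper_set h"
  shows "octahedron h n i j \<in> laurent_ring \<and>
    (\<forall>p :: laurent. octahedron h n i j = laurent_value p \<longrightarrow>
       (\<forall>e\<in>Poly_Mapping.keys p.
          Poly_Mapping.lookup p e = 1 \<and>
          (\<forall>i' j'. - 1 \<le> Poly_Mapping.lookup e (Face i' j') \<and> Poly_Mapping.lookup e (Face i' j') \<le> 3) \<and>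
          (\<forall>q. Poly_Mapping.lookup e (EdgeA q) \<in> {0, 1} \<and> Poly_Mapping.lookup e (EdgeB q) \<in> {0, 1} \<and>
               Poly_Mapping.lookup e (EdgeC q) \<in> {0, 1} \<and> Poly_Mapping.lookup e (EdgeD q) \<in> {0, 1})))"
proof -
  define D where "D = {(k, l). h k l < cone n i j k l}"
  define B where "B = (\<Union>(k, l)\<in>D. incident_sides k l)"
  define P where "P = insert (i, j) (\<Union>(k, l)\<in>D. near_faces k l)"
  define g where "g = (\<lambda>k l. min (h k l) (cone n i j k l))"
  have "finite D"
    unfolding D_def by (rule finite_below_cone[OF assms(1)])
  hence fin: "finite B" "finite P"
    by (auto simp: B_def P_def incident_sides_def near_faces_def)
  have apex: "even (n + i + j)"
    using assms(2) unfolding upper_set_def lattice_def cong_iff_dvd_diff by auto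
  have g: "step_height g"
    unfolding g_def by (intro step_height_min height_function_step assms step_height_cone apex)
  define Ms where "Ms = {M. M \<subseteq> B \<and> config g M}"
  have finite_Ms: "finite M" if "M \<in> Ms" for M
    using that fin by (auto simp: Ms_def intro: finite_subset)
  have "finite Ms"
    using fin by (simp add: Ms_def)
  have inj: "inj_on (exponent_vector P g) Ms"
    using inj_on_exponent_vector[OF g] by (rule inj_on_subset) (auto simp: finite_Ms)
  define q :: laurent where "q = (\<Sum>M\<in>Ms. Poly_Mapping.single (exponent_vector P g M) 1)"
  have "octahedron h n i j = partition_sum (octahedron h) B P g"
    by (rule partition_sum_between[OF assms(1) apex fin _ _ _ g, symmetric])
       (auto simp: B_def P_def D_def g_def)
  also have "\<dots> = (\<Sum>M\<in>Ms. laurent_monomial (exponent_vector P g M))"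
    unfolding partition_sum_def Ms_def[symmetric]
    by (intro sum.cong refl laurent_monomial_exponent_vector[symmetric])
       (simp add: g_def octahedron_below)
  also have "\<dots> = laurent_value q"
    by (simp add: q_def laurent_value_sum laurent_value_single)
  finally have expansion: "octahedron h n i j = laurent_value q" .
  \<comment> \<open>Injectivity on \<open>Ms\<close> prevents two configurations from adding up in
    one coefficient, which gives the coefficient 1.\<close>
  have lookup_q: "Poly_Mapping.lookup q e = of_bool (e \<in> exponent_vector P g ` Ms)" for e
  proof -
    have "Poly_Mapping.lookup q e = (\<Sum>e'\<in>exponent_vector P g ` Ms. if e = e' then 1 else 0)"
      using inj by (simp add: q_def lookup_sum sum.reindex lookup_single when_def)
    thus ?thesis
      using \<open>finite Ms\<close> by simp
  qed
  hence keys_q: "Poly_Mapping.keys q = exponent_vector P g ` Ms"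
    by (auto simp: in_keys_iff)
  note edge = lookup_exponent_vector_edge[OF g finite_Ms]
  have "octahedron h n i j \<in> laurent_ring"
    unfolding expansion laurent_ring_def
    by (rule imageI) (auto simp: keys_q edge)
  moreover have "Poly_Mapping.lookup q e = 1 \<and>
      (\<forall>i' j'. - 1 \<le> Poly_Mapping.lookup e (Face i' j') \<and> Poly_Mapping.lookup e (Face i' j') \<le> 3) \<and>
      (\<forall>r. Poly_Mapping.lookup e (EdgeA r) \<in> {0, 1} \<and> Poly_Mapping.lookup e (EdgeB r) \<in> {0, 1} \<and>
           Poly_Mapping.lookup e (EdgeC r) \<in> {0, 1} \<and> Poly_Mapping.lookup e (EdgeD r) \<in> {0, 1})"
    if key: "e \<in> Poly_Mapping.keys q" for e
  proof -
    obtain M where M: "M \<in> Ms" and e: "e = exponent_vector P g M"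
      using key by (auto simp: keys_q)
    hence cfg: "config g M"
      by (simp add: Ms_def)
    show ?thesis
      using key face_exponent_bounds[OF g cfg]
      by (auto simp: lookup_q keys_q e edge[OF M] lookup_exponent_vector_face[OF fin(2)])
  qed
  ultimately show ?thesis
    unfolding expansion laurent_value_inject by blast
qed

end
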